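(* Let $0<\beta\le 1$, $\lambda>0$, and let $W_\beta^f(t)=N_\beta(E_f(t))$, $t\ge 0$, where $\{N_\beta(t)\}_{t\ge0}$ is the fractional Poisson process with parameters $\beta,\lambda$ and $\{E_f(t)\}_{t\ge0}$ is the inverse of a subordinator $\{D_f(t)\}_{t\ge0}$ with Bernstein function $f$, independent of $\{N_\beta(t)\}_{t\ge0}$. Let $0\le s<t$ and let $0\le m\le n$ be integers. Let $\{E_\phi(t)\}_{t\ge0}$ be the inverse subordinator corresponding to $\phi(s)=(f(s))^\beta$, and let $F(t)=1-\mathbb{E}[e^{-\lambda E_\phi(t)}]$, $t\ge0$. Then, if $n=m\ge0$, $$\mathbb{P}[W_\beta^f(s)=m,\,W_\beta^f(t)=m]=\int_0^s\mathbb{E}\big[e^{-\lambda E_\phi(t-u)}\big]\,dF^{*m}(u),$$ and, if $n\ge m+1$, $$\mathbb{P}[W_\beta^f(s)=m,\,W_\beta^f(t)=n]=\int_0^s dF^{*m}(u)\int_{s-u}^{t-u}dF(v)\int_0^{t-(u+v)}\mathbb{E}\big[e^{-\lambda E_\phi(t-u-v-x)}\big]\,dF^{*(n-m-1)}(x).$$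
   Context: Notation: $dF^{*k}$ is the $k$-fold convolution of the probability measure $dF$ on $[0,\infty)$ for $k\ge1$, and $dF^{*0}=\delta_0$ is the Dirac measure at $0$; integrals $\int_0^a$ against these measures include the endpoint $0$. Subordinator and its inverse: $\{D_f(t)\}_{t\ge 0}$ is a nondecreasing Lévy process with $D_f(0)=0$ a.s. and $\mathbb{E}[e^{-sD_f(t)}]=e^{-tf(s)}$, $s>0$, where $f$ is the Bernstein function $f(s)=bs+\int_0^\infty(1-e^{-sx})\,\nu(dx)$, with $b\ge0$ and $\nu$ a non-negative Lévy measure on $(0,\infty)$ satisfying $\int_0^\infty (x\wedge1)\,\nu(dx)<\infty$ and $\nu(0,\infty)=\infty$ (so sample paths are a.s. strictly increasing). The inverse subordinator corresponding to $f$ is $E_f(t)=\inf\{r\ge0:D_f(r)>t\}$, $t\ge0$. Likewise $E_\phi(t)=\inf\{r\ge0:D_\phi(r)>t\}$, where $\{D_\phi(t)\}$ is a subordinator with $\mathbb{E}[e^{-sD_\phi(t)}]=e^{-t\phi(s)}$. Fractional Poisson process (FPP): for $0<\beta<1$, let $\{D_\beta(t)\}$ be the $\beta$-stable subordinator, $\mathbb{E}[e^{-sD_\beta(t)}]=e^{-ts^\beta}$, and $E_\beta(t)=\inf\{r\ge0: D_\beta(r)>t\}$ the inverse $\beta$-stable subordinator. The FPP is $N_\beta(t)=N_\beta(t,\lambda)=N(E_\beta(t),\lambda)$, where $\{N(t,\lambda)\}$ is a Poisson process of rate $\lambda>0$ independent of $E_\beta$. For $\beta=1$ the FPP is the Poisson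 process of rate $\lambda$. *)

theory Defs
  imports "HOL-Probability.Probability"
begin

text \<open>
  Processes indexed by \<open>[0, \<infinity>)\<close> are functions on \<^typ>\<open>real\<close> of which only the values at
  nonnegative times matter. Regularity of paths is required almost surely only, so functionals of
  a whole path, such as a first-passage time, are measurable only up to null sets. For this reason
  independence of two processes, and below the probabilities and expectations involving inverse
  subordinators, refer to \<^term>\<open>completion M\<close>. This has the same value as \<open>M\<close> on every event of
  \<open>M\<close>, and nothing changes if \<open>M\<close> is complete.
\<close>

definition indep_processes ::
  "'w measure \<Rightarrow> (real \<Rightarrow> 'w \<Rightarrow> real) \<Rightarrow> (real \<Rightarrow> 'w \<Rightarrow> real) \<Rightarrow> bool"
where
  "indep_processes M X Y \<longleftrightarrow>
     prob_space.indep_var (completion M)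
       (\<Pi>\<^sub>M t\<in>{0..}. borel) (\<lambda>\<omega>. \<lambda>t\<in>{0..}. X t \<omega>)
       (\<Pi>\<^sub>M t\<in>{0..}. borel) (\<lambda>\<omega>. \<lambda>t\<in>{0..}. Y t \<omega>)"

definition independent_increments :: "'w measure \<Rightarrow> (real \<Rightarrow> 'w \<Rightarrow> real) \<Rightarrow> bool" where
  "independent_increments M X \<longleftrightarrow>
     (\<forall>(\<tau>::nat \<Rightarrow> real) n. 0 \<le> \<tau> 0 \<and> (\<forall>i<n. \<tau> i \<le> \<tau> (Suc i)) \<longrightarrow>
        prob_space.indep_vars M (\<lambda>_. borel) (\<lambda>i \<omega>. X (\<tau> (Suc i)) \<omega> - X (\<tau> i) \<omega>) {..<n})"

definition stationary_increments :: "'w measure \<Rightarrow> (real \<Rightarrow> 'w \<Rightarrow> real) \<Rightarrow> bool" where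
  "stationary_increments M X \<longleftrightarrow>
     (\<forall>s\<ge>0. \<forall>h\<ge>0. distr M borel (\<lambda>\<omega>. X (s + h) \<omega> - X s \<omega>) = distr M borel (X h))"

definition cadlag :: "(real \<Rightarrow> real) \<Rightarrow> bool" where
  "cadlag x \<longleftrightarrow>
     (\<forall>t\<ge>0. (x \<longlongrightarrow> x t) (at_right t)) \<and> (\<forall>t>0. \<exists>l. (x \<longlongrightarrow> l) (at_left t))"

text \<open>
  Continuity in probability is not listed separately: it follows from right-continuity together
  with stationarity of the increments.
\<close>

definition levy_process :: "'w measure \<Rightarrow> (real \<Rightarrow> 'w \<Rightarrow> real) \<Rightarrow> bool" where
  "levy_process M X \<longleftrightarrow>
     (\<forall>t\<ge>0. X t \<in> borel_measurable M) \<and>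
     (AE \<omega> in M. X 0 \<omega> = 0) \<and>
     independent_increments M X \<and>
     stationary_increments M X \<and>
     (AE \<omega> in M. cadlag (\<lambda>t. X t \<omega>))"

definition subordinator :: "'w measure \<Rightarrow> (real \<Rightarrow> real) \<Rightarrow> (real \<Rightarrow> 'w \<Rightarrow> real) \<Rightarrow> bool" where
  "subordinator M \<psi> D \<longleftrightarrow>
     levy_process M D \<and>
     (AE \<omega> in M. mono_on {0..} (\<lambda>t. D t \<omega>)) \<and>
     (\<forall>t\<ge>0. \<forall>x>0. (\<integral>\<omega>. exp (- x * D t \<omega>) \<partial>M) = exp (- t * \<psi> x))"

definition inverse_process :: "(real \<Rightarrow> 'w \<Rightarrow> real) \<Rightarrow> real \<Rightarrow> 'w \<Rightarrow> real" where
  "inverse_process D t \<omega> = Inf {r. 0 \<le> r \<and> t < D r \<omega>}"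

text \<open>\<open>\<nu>\<close> is a measure on the space \<open>(0, \<infinity>)\<close>, so integrals against \<open>\<nu>\<close> range over \<open>(0, \<infinity>)\<close>.\<close>

definition levy_measure :: "real measure \<Rightarrow> bool" where
  "levy_measure \<nu> \<longleftrightarrow>
     sets \<nu> = sets (restrict_space borel {0<..}) \<and> (\<integral>\<^sup>+x. ennreal (min x 1) \<partial>\<nu>) < \<infinity>"

definition bernstein_function :: "real \<Rightarrow> real measure \<Rightarrow> real \<Rightarrow> real" where
  "bernstein_function b \<nu> x = b * x + (\<integral>y. (1 - exp (- x * y)) \<partial>\<nu>)"

definition poisson_process :: "'w measure \<Rightarrow> real \<Rightarrow> (real \<Rightarrow> 'w \<Rightarrow> nat) \<Rightarrow> bool" where
  "poisson_process M rate N \<longleftrightarrow>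
     levy_process M (\<lambda>t \<omega>. real (N t \<omega>)) \<and>
     (\<forall>t>0. distr M (count_space UNIV) (N t) = measure_pmf (poisson_pmf (rate * t)))"

definition fractional_poisson_process ::
  "'w measure \<Rightarrow> real \<Rightarrow> real \<Rightarrow> (real \<Rightarrow> 'w \<Rightarrow> nat) \<Rightarrow> bool"
where
  "fractional_poisson_process M \<beta> rate X \<longleftrightarrow>
     (if \<beta> = 1 then poisson_process M rate X
      else \<exists>N D. poisson_process M rate N \<and>
                 subordinator M (\<lambda>x. x powr \<beta>) D \<and>
                 indep_processes M (\<lambda>t \<omega>. real (N t \<omega>)) (inverse_process D) \<and>
                 (\<forall>t\<ge>0. \<forall>\<omega>\<in>space M. X t \<omega> = N (inverse_process D t \<omega>) \<omega>))"

text \<open>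
  The Lebesgue--Stieltjes measure \<open>dF\<close> of a distribution function \<open>F\<close> on \<open>[0, \<infinity>)\<close>; \<open>F\<close> is
  extended by \<open>0\<close> to negative arguments.
\<close>

definition stieltjes_measure :: "(real \<Rightarrow> real) \<Rightarrow> real measure" where
  "stieltjes_measure F = interval_measure (\<lambda>x. if x < 0 then 0 else F x)"

primrec convolution_power :: "real measure \<Rightarrow> nat \<Rightarrow> real measure" where
  "convolution_power \<mu> 0 = return borel 0"
| "convolution_power \<mu> (Suc k) = convolution \<mu> (convolution_power \<mu> k)"

end

theory Submission
  imports Defs "HOL-Real_Asymp.Real_Asymp"
begin

text \<open>
  The Poisson process is a renewal process with exponential waiting times. For a renewal process
  with waiting time law \<open>Q\<close> and arrival times \<open>T\<^sub>i\<close>, the joint law at two times is determined by the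
  probabilities of \<open>T\<^sub>i \<le> a\<close>, \<open>T\<^sub>i\<^sub>+\<^sub>j \<le> b\<close>. Replace \<open>a \<le> b\<close> by \<open>E s \<le> E t\<close>, where \<open>E\<close> is the inverse of an
  independent subordinator \<open>D\<close>: as \<open>r \<le> E s\<close> is almost surely equivalent to \<open>D r \<le> s\<close>, and \<open>D\<close> has
  stationary independent increments, the result is again of renewal type, with the waiting time law
  \<open>\<integral> P(D r \<in> \<cdot>) Q(dr)\<close>. The Laplace transform of this law is that of \<open>Q\<close> composed with the Laplace
  exponent of \<open>D\<close>. Two such steps, with exponents \<open>x\<^sup>\<beta>\<close> (void if \<open>\<beta> = 1\<close>) and \<open>f\<close>, lead from the Poisson process to \<open>W\<close>.
  One step with exponent \<open>f\<^sup>\<beta>\<close> leads to a waiting time law with the same Laplace transform, and its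
  distribution function is \<open>F\<close>. That \<open>dF\<close> has no atoms makes the closed interval \<open>[s - u, t - u]\<close> as
  good as the half-open one.
\<close>

subsection \<open>Laws on the half-line\<close>

text \<open>What survives a time change is the function \<open>joint_prob\<close>: averaged over an
  inverse subordinator, \<open>joint_prob P Q\<close> becomes \<open>joint_prob\<close> of the mixed
  laws \<open>P \<bind> K\<close> and \<open>Q \<bind> K\<close>. This is why the two-point law is
  stored as a signed sum of four such terms and turned into an iterated integral only when it is
  evaluated. No renewal process is constructed; the Poisson process enters through its two-point
  probabilities, which are computed to have this form for the exponential law. The mixtures reached
  along the two routes come from subordinators on different probability spaces. They meet only in
  their Laplace transform, which is \<open>rate / (rate + f x powr \<beta>)\<close> for both. The
  obstacle is regularity. Path properties hold almost surely, so a first-passage time is measurable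
  only for the completion, and its equivalence with an event of \<open>D\<close> has an exceptional
  null set for each pair of a time and a level. Evaluating a process at a random time asks for joint
  measurability, in place of which stand right-continuity and dyadic times.\<close>

locale nonneg_law = prob_space P for P :: "real measure" +
  assumes sets_P[measurable_cong, simp]: "sets P = sets borel"
    and nonneg: "AE x in P. 0 \<le> x"
begin

lemma space_P[simp]: "space P = UNIV"
  using sets_eq_imp_space_eq[OF sets_P] by simp

lemma measure_UNIV[simp]: "measure P UNIV = 1"
  using prob_space by simp

lemma emeasure_UNIV[simp]: "emeasure P UNIV = 1"
  using emeasure_space_1 by simp

lemma real_distribution: "real_distribution P"
  by standard simp

lemma measure_greaterThan: "measure P {c<..} = 1 - measure P {..c}"
proof -
  have "UNIV - {..c} = {c<..}" by auto
  then show ?thesis using prob_compl[of "{..c}"] by simp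
qed

lemma cdf_measurable: "(\<lambda>c. measure P {..c}) \<in> borel_measurable borel"
  by (rule borel_measurable_mono) (auto intro!: monoI finite_measure_mono)

lemma survival_measurable: "(\<lambda>c. measure P {c<..}) \<in> borel_measurable borel"
  unfolding measure_greaterThan using cdf_measurable by measurable

end

lemma nonneg_law_convolution:
  assumes "nonneg_law P" "nonneg_law Q"
  shows "nonneg_law (convolution P Q)"
proof -
  interpret P: nonneg_law P by fact
  interpret Q: nonneg_law Q by fact
  interpret PQ: pair_prob_space P Q ..
  have "AE z in P \<Otimes>\<^sub>M Q. 0 \<le> (\<lambda>(x, y). x + y) z"
  proof (rule PQ.AE_pair_measure)
    show "AE x in P. AE y in Q. 0 \<le> (\<lambda>(x, y). x + y) (x, y)"
      using P.nonneg by eventually_elim (use Q.nonneg in \<open>auto elim!: eventually_mono\<close>)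
  qed measurable
  then show ?thesis
    unfolding nonneg_law_def nonneg_law_axioms_def convolution_def
    by (auto simp: AE_distr_iff intro!: PQ.prob_space_distr)
qed

lemma nonneg_law_return: "0 \<le> x \<Longrightarrow> nonneg_law (return borel x)"
  by (auto simp: nonneg_law_def nonneg_law_axioms_def AE_return intro!: prob_space_return)

lemma nonneg_law_convolution_power:
  "nonneg_law Q \<Longrightarrow> nonneg_law (convolution_power Q n)"
  by (induction n) (auto intro: nonneg_law_convolution nonneg_law_return)

lemma nonneg_law_distr:
  assumes "prob_space M" "X \<in> borel_measurable M" "AE \<omega> in M. 0 \<le> X \<omega>"
  shows "nonneg_law (distr M borel X)"
  using assms by (auto simp: nonneg_law_def nonneg_law_axioms_def AE_distr_iff
      intro!: prob_space.prob_space_distr)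

text \<open>Valued in \<open>ennreal\<close> so that Fubini and \<open>nn_integral_bind\<close>
  apply without integrability conditions.\<close>

definition laplace_transform :: "real measure \<Rightarrow> real \<Rightarrow> ennreal" where
  "laplace_transform P x = (\<integral>\<^sup>+y. ennreal (exp (- x * y)) \<partial>P)"

lemma laplace_transform_convolution:
  assumes "nonneg_law P" "nonneg_law Q"
  shows "laplace_transform (convolution P Q) x = laplace_transform P x * laplace_transform Q x"
proof -
  interpret P: nonneg_law P by fact
  interpret Q: nonneg_law Q by fact
  have "laplace_transform (convolution P Q) x
      = (\<integral>\<^sup>+u. \<integral>\<^sup>+v. ennreal (exp (- x * u)) * ennreal (exp (- x * v)) \<partial>Q \<partial>P)"
    unfolding laplace_transform_def
    by (subst nn_integral_convolution)
       (auto simp: P.finite_measure_axioms Q.finite_measure_axioms algebra_simps exp_diff exp_minus field_simps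
          simp flip: ennreal_mult exp_add intro!: nn_integral_cong)
  also have "\<dots> = laplace_transform P x * laplace_transform Q x"
    unfolding laplace_transform_def
    by (simp add: nn_integral_cmult nn_integral_multc)
  finally show ?thesis .
qed

lemma laplace_transform_return: "laplace_transform (return borel y) x = ennreal (exp (- x * y))"
  unfolding laplace_transform_def by (subst nn_integral_return) auto

lemma laplace_transform_convolution_power:
  "nonneg_law Q \<Longrightarrow> laplace_transform (convolution_power Q n) x = laplace_transform Q x ^ n"
  by (induction n)
     (simp_all add: laplace_transform_return laplace_transform_convolution nonneg_law_convolution_power)

lemma (in nonneg_law) laplace_transform_eq_integral:
  assumes "0 \<le> x"
  shows "laplace_transform P x = ennreal (\<integral>y. exp (- x * y) \<partial>P)"
  unfolding laplace_transform_def
proof (rule nn_integral_eq_integral)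
  show "integrable P (\<lambda>y. exp (- x * y))"
    by (rule integrable_const_bound[where B=1]) (use nonneg assms in \<open>auto elim!: eventually_mono\<close>)
qed simp

text \<open>
  Substituting \<open>z = exp (- y)\<close> turns the Laplace transforms at integer arguments into the moments
  of a law on \<open>[0, 1]\<close>, and these determine it by the Weierstrass approximation theorem.
\<close>

lemma integral_of_exp_neg_eq:
  fixes h :: "real \<Rightarrow> real"
  assumes "nonneg_law P" "nonneg_law Q"
    and eq: "\<And>x. 0 < x \<Longrightarrow> laplace_transform P x = laplace_transform Q x"
    and cont: "continuous_on {0..1::real} h"
  shows "(\<integral>y. h (exp (- max 0 y)) \<partial>P) = (\<integral>y. h (exp (- max 0 y)) \<partial>Q)"
proof -
  interpret P: nonneg_law P by fact
  interpret Q: nonneg_law Q by fact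
  \<comment> \<open>The truncation \<open>max 0 y\<close> changes nothing almost everywhere, but
    puts \<open>?e y\<close> into \<open>{0..1}\<close> for every \<open>y\<close>, so that
    \<open>h\<close> is only ever evaluated where it is continuous and bounded.\<close>
  let ?e = "\<lambda>y. exp (- max 0 y :: real)"
  have range: "?e y \<in> {0..1}" for y by auto
  have moments: "(\<integral>y. ?e y ^ k \<partial>P) = (\<integral>y. ?e y ^ k \<partial>Q)" for k
  \<comment> \<open>Transforms are known to agree at positive arguments only; the zeroth moment is
    the total mass.\<close>
  proof (cases k)
    case (Suc j)
    have "(\<integral>y. ?e y ^ k \<partial>R) = (\<integral>y. exp (- real k * y) \<partial>R)" if "nonneg_law R" for R
    proof -
      interpret R: nonneg_law R by fact
      show ?thesis
      proof (rule integral_cong_AE)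
        show "AE y in R. ?e y ^ k = exp (- real k * y)"
          using R.nonneg by eventually_elim (simp add: exp_of_nat_mult[symmetric] max_absorb2)
      qed simp_all
    qed
    moreover have "(\<integral>y. exp (- real k * y) \<partial>P) = (\<integral>y. exp (- real k * y) \<partial>Q)"
      using eq[of "real k"] Suc
      by (simp add: P.laplace_transform_eq_integral Q.laplace_transform_eq_integral
          ennreal_inj integral_nonneg)
    ultimately show ?thesis using assms by simp
  qed (use P.prob_space Q.prob_space in simp)
  have intp: "integrable R (\<lambda>y. ?e y ^ k)" if "nonneg_law R" for R k
  proof -
    interpret R: nonneg_law R by fact
    show ?thesis
      by (rule R.integrable_const_bound[where B=1]) (auto simp: power_le_one)
  qed
  have poly: "(\<integral>y. p (?e y) \<partial>P) = (\<integral>y. p (?e y) \<partial>Q)" if p: "real_polynomial_function p" for p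
  proof -
    obtain a n where "p = (\<lambda>x. \<Sum>i\<le>n. a i * x ^ i)"
      using p real_polynomial_function_iff_sum by blast
    then show ?thesis
      using intp[OF assms(1)] intp[OF assms(2)] by (simp add: moments)
  qed
  have hm: "(\<lambda>y. h (?e y)) \<in> borel_measurable borel"
    by (rule measurable_compose[OF _ borel_measurable_continuous_on_restrict[OF cont]])
       (auto intro!: measurable_restrict_space2)
  show ?thesis
  proof (rule ccontr)
    \<comment> \<open>A uniform error of \<open>d / 4\<close> under each of the two laws closes a
      gap of at most \<open>d / 2\<close>, less than \<open>d\<close>.\<close>
    define d where "d = \<bar>(\<integral>y. h (?e y) \<partial>P) - (\<integral>y. h (?e y) \<partial>Q)\<bar>"
    assume "\<not> ?thesis"
    then have "d / 4 > 0" by (simp add: d_def)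
    then obtain p where p: "real_polynomial_function p" "\<And>x. x \<in> {0..1} \<Longrightarrow> \<bar>h x - p x\<bar> < d / 4"
      using Stone_Weierstrass_real_polynomial_function[OF compact_Icc cont] by blast
    have close: "\<bar>(\<integral>y. h (?e y) \<partial>R) - (\<integral>y. p (?e y) \<partial>R)\<bar> \<le> d / 4" if "nonneg_law R" for R
    proof -
      interpret R: nonneg_law R by fact
      have pc: "continuous_on {0..1} p"
        using p(1) continuous_on_polymonial_function real_polynomial_function_eq by blast
      have pm: "(\<lambda>y. p (?e y)) \<in> borel_measurable borel"
        by (rule measurable_compose[OF _ borel_measurable_continuous_on_restrict[OF pc]])
           (auto intro!: measurable_restrict_space2)
      have bdd: "integrable R (\<lambda>y. g (?e y))"
        if g: "continuous_on {0..1} g" "(\<lambda>y. g (?e y)) \<in> borel_measurable borel" for g :: "real \<Rightarrow> real"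
      proof -
        obtain B where "\<And>x. x \<in> {0..1} \<Longrightarrow> norm (g x) \<le> B"
          using compact_imp_bounded[OF compact_continuous_image[OF g(1) compact_Icc]]
          unfolding bounded_iff by blast
        then have B: "AE y in R. norm (g (?e y)) \<le> B" using range by blast
        have "(\<lambda>y. g (?e y)) \<in> borel_measurable R"
          using g(2) by (simp add: measurable_cong_sets[OF R.sets_P refl])
        with B show ?thesis by (rule R.integrable_const_bound)
      qed
      note int = bdd[OF cont hm] bdd[OF pc pm]
      have "\<bar>(\<integral>y. h (?e y) \<partial>R) - (\<integral>y. p (?e y) \<partial>R)\<bar> = \<bar>\<integral>y. h (?e y) - p (?e y) \<partial>R\<bar>"
        by (subst Bochner_Integration.integral_diff[OF int]) simp
      also have "\<dots> \<le> (\<integral>y. d / 4 \<partial>R)"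
        by (rule integral_abs_bound_integral[OF Bochner_Integration.integrable_diff[OF int]])
           (use p(2)[OF range] less_imp_le in auto)
      finally show ?thesis by (simp add: R.prob_space)
    qed
    have "False" if "\<bar>x - z\<bar> \<le> d / 4" "\<bar>y - z\<bar> \<le> d / 4" "d = \<bar>x - y\<bar>" for x y z :: real
      using that \<open>d / 4 > 0\<close> by linarith
    then show False
      using close[OF assms(1)] close[OF assms(2)] unfolding poly[OF p(1)] by (auto simp: d_def)
  qed
qed

text \<open>In the variable \<open>z = exp (- y)\<close> the half-line \<open>y \<le> a\<close>
  reads \<open>z \<ge> exp (- a)\<close>. The ramps \<open>h n\<close> are continuous, equal 1 from
  \<open>exp (- a)\<close> on and 0 below \<open>exp (- a) - 1 / n\<close>. They converge to the
  indicator at every point, the endpoint included, so dominated convergence recovers the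
  distribution function at each \<open>a\<close>.\<close>

lemma laplace_transform_unique:
  assumes "nonneg_law P" "nonneg_law Q"
    and eq: "\<And>x. 0 < x \<Longrightarrow> laplace_transform P x = laplace_transform Q x"
  shows "P = Q"
proof -
  interpret P: nonneg_law P by fact
  interpret Q: nonneg_law Q by fact
  have limit: "(\<lambda>n. \<integral>y. h n (exp (- max 0 y)) \<partial>R) \<longlonglongrightarrow> cdf R a"
    if "nonneg_law R" "0 \<le> a" and h: "h = (\<lambda>n z. min 1 (max 0 (1 + real n * (z - exp (- a)))))" for R a h
  proof -
    interpret R: nonneg_law R by fact
    have "(\<lambda>n. \<integral>y. h n (exp (- max 0 y)) \<partial>R) \<longlonglongrightarrow> (\<integral>y. indicator {..a} y \<partial>R)"
    proof (rule integral_dominated_convergence[where w="\<lambda>_. 1"])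
      show "AE y in R. (\<lambda>n. h n (exp (- max 0 y))) \<longlonglongrightarrow> indicator {..a} y"
      proof (rule AE_I2)
        fix y
        show "(\<lambda>n. h n (exp (- max 0 y))) \<longlonglongrightarrow> indicator {..a} y"
        proof (cases "y \<le> a")
          case True
          then have "exp (- max 0 y) - exp (- a) \<ge> 0" using \<open>0 \<le> a\<close> by simp
          then have "h n (exp (- max 0 y)) = 1" for n
            unfolding h by (smt (verit) mult_nonneg_nonneg of_nat_0_le_iff)
          then show ?thesis using True by simp
        next
          case False
          define e where "e = exp (- a) - exp (- max 0 y)"
          have "e > 0" using False \<open>0 \<le> a\<close> by (simp add: e_def)
          have "h n (exp (- max 0 y)) = 0" if "n \<ge> nat \<lceil>1 / e\<rceil>" for n
          proof -
            have "real n \<ge> 1 / e" using that by linarith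
            then have "real n * e \<ge> 1" using \<open>e > 0\<close> by (simp add: field_simps)
            then show ?thesis unfolding h by (simp add: e_def algebra_simps)
          qed
          then have "\<forall>\<^sub>F n in sequentially. h n (exp (- max 0 y)) = indicator {..a} y"
            using False unfolding eventually_sequentially by (intro exI[of _ "nat \<lceil>1 / e\<rceil>"]) simp
          then show ?thesis by (rule tendsto_eventually)
        qed
      qed
    qed (auto simp: h)
    then show ?thesis by (simp add: cdf_def)
  qed
  have "cdf P a = cdf Q a" for a
  proof (cases "0 \<le> a")
    case True
    define h :: "nat \<Rightarrow> real \<Rightarrow> real" where "h = (\<lambda>n z. min 1 (max 0 (1 + real n * (z - exp (- a)))))"
    have "(\<integral>y. h n (exp (- max 0 y)) \<partial>P) = (\<integral>y. h n (exp (- max 0 y)) \<partial>Q)" for n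
      by (rule integral_of_exp_neg_eq[OF assms(1,2) eq]) (auto simp: h_def intro!: continuous_intros)
    then show ?thesis
      using limit[OF assms(1) True h_def] limit[OF assms(2) True h_def] LIMSEQ_unique by auto
  next
    case False
    have "cdf R a = 0" if "nonneg_law R" for R
    proof -
      interpret R: nonneg_law R by fact
      show ?thesis
        unfolding cdf_def by (subst R.prob_eq_0) (use R.nonneg False in \<open>auto elim!: eventually_mono\<close>)
    qed
    then show ?thesis using assms by simp
  qed
  then show ?thesis
    by (intro cdf_unique P.real_distribution Q.real_distribution) auto
qed

subsection \<open>Two-point probabilities of renewal processes\<close>

text \<open>The second law is that of the gap between two arrival times, not of the later arrival
  time: the gap is independent of the earlier time, and a time change acts on the two laws
  separately.\<close>

definition joint_prob :: "real measure \<Rightarrow> real measure \<Rightarrow> real \<Rightarrow> real \<Rightarrow> real" where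
  "joint_prob P Q a b = measure (P \<Otimes>\<^sub>M Q) {(u, v). u \<le> a \<and> u + v \<le> b}"

text \<open>
  The probability that a renewal process with waiting time law \<open>Q\<close> takes the values \<open>m\<close> and \<open>n\<close> at
  the times \<open>a \<le> b\<close>, by inclusion and exclusion from the joint laws of pairs of arrival times.
  For \<open>n = m\<close> the truncated subtraction makes the second and the fourth term cancel, as they should.
\<close>

definition renewal_prob :: "real measure \<Rightarrow> nat \<Rightarrow> nat \<Rightarrow> real \<Rightarrow> real \<Rightarrow> real" where
  "renewal_prob Q m n a b =
     joint_prob (convolution_power Q m) (convolution_power Q (n - m)) a b
     - joint_prob (convolution_power Q (Suc m)) (convolution_power Q (n - m - 1)) a b
     - joint_prob (convolution_power Q m) (convolution_power Q (Suc (n - m))) a b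
     + joint_prob (convolution_power Q (Suc m)) (convolution_power Q (n - m)) a b"

lemma Collect_in_sets: "Measurable.pred M R \<Longrightarrow> space M = UNIV \<Longrightarrow> Collect R \<in> sets M"
  by (simp add: pred_def)

lemma emeasure_pair_nonneg_law:
  assumes "nonneg_law P" "nonneg_law Q" and [measurable]: "Measurable.pred (borel \<Otimes>\<^sub>M borel) (\<lambda>(u, v). R u v)"
  shows "emeasure (P \<Otimes>\<^sub>M Q) {(u, v). R u v} = (\<integral>\<^sup>+u. \<integral>\<^sup>+v. indicator {(u, v). R u v} (u, v) \<partial>Q \<partial>P)"
proof -
  interpret P: nonneg_law P by fact
  interpret Q: nonneg_law Q by fact
  have "{(u, v). R u v} \<in> sets (P \<Otimes>\<^sub>M Q)"
    using assms(3) by (simp add: pred_def space_pair_measure case_prod_beta')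
  then show ?thesis by (rule Q.emeasure_pair_measure)
qed

lemma joint_pred_measurable [measurable]:
  "Measurable.pred (borel \<Otimes>\<^sub>M borel) (\<lambda>(u, v). u \<le> a \<and> u + v \<le> (b::real))"
  by measurable

lemma joint_set_borel [measurable]: "{(u, v). u \<le> a \<and> u + v \<le> b} \<in> sets (borel \<Otimes>\<^sub>M (borel :: real measure))"
  using joint_pred_measurable[of a b] by (simp add: pred_def space_pair_measure case_prod_beta')

lemma ennreal_joint_prob:
  assumes "nonneg_law P" "nonneg_law Q"
  shows "ennreal (joint_prob P Q a b) = (\<integral>\<^sup>+u. \<integral>\<^sup>+v. indicator {(u, v). u \<le> a \<and> u + v \<le> b} (u, v) \<partial>Q \<partial>P)"
proof -
  interpret P: nonneg_law P by fact
  interpret Q: nonneg_law Q by fact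
  interpret PQ: pair_prob_space P Q ..
  show ?thesis
    unfolding joint_prob_def PQ.emeasure_eq_measure[symmetric]
    by (rule emeasure_pair_nonneg_law[OF assms joint_pred_measurable])
qed

lemma (in prob_space) measure_pair_eq_integral:
  assumes "prob_space N" and S[measurable]: "S \<in> sets (M \<Otimes>\<^sub>M N)"
  shows "measure (M \<Otimes>\<^sub>M N) S = (\<integral>x. measure N (Pair x -` S) \<partial>M)"
proof -
  interpret N: prob_space N by fact
  interpret MN: pair_prob_space M N ..
  have "ennreal (measure (M \<Otimes>\<^sub>M N) S) = (\<integral>\<^sup>+x. ennreal (measure N (Pair x -` S)) \<partial>M)"
    by (simp add: N.emeasure_pair_measure_alt N.emeasure_eq_measure flip: MN.emeasure_eq_measure)
  also have "\<dots> = ennreal (\<integral>x. measure N (Pair x -` S) \<partial>M)"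
  proof (rule nn_integral_eq_integral)
    have "(\<lambda>x. measure N (Pair x -` S)) \<in> borel_measurable M"
      unfolding measure_def using N.measurable_emeasure_Pair[OF S] by measurable
    then show "integrable M (\<lambda>x. measure N (Pair x -` S))"
      by (intro integrable_const_bound[where B=1]) auto
  qed simp
  finally show ?thesis by (simp add: integral_nonneg)
qed

text \<open>
  The four variables are the \<open>m\<close>-th arrival time and the waiting times after it, the third of them
  combining the \<open>k\<close> waiting times that separate the two jumps straddling \<open>a\<close> and \<open>b\<close>.
\<close>

lemma renewal_prob_jump:
  assumes Q: "nonneg_law Q" and "a \<le> b"
  shows "renewal_prob Q m (m + 1 + k) a b =
    (\<integral>u. indicator {..a} u * (\<integral>v. indicator {a - u<..b - u} v *
      (\<integral>x. indicator {..b - (u + v)} x * measure Q {b - u - v - x<..} \<partial>convolution_power Q k) \<partial>Q)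
     \<partial>convolution_power Q m)"
proof -
  define A where "A = convolution_power Q m"
  define B where "B = convolution_power Q k"
  have AB: "nonneg_law A" "nonneg_law B" "nonneg_law (convolution Q B)" "nonneg_law (convolution B Q)"
      "nonneg_law (convolution A Q)" "nonneg_law (convolution Q (convolution B Q))"
    unfolding A_def B_def using Q by (auto intro!: nonneg_law_convolution_power nonneg_law_convolution)
  interpret Q: nonneg_law Q by fact
  interpret A: nonneg_law A by fact
  interpret B: nonneg_law B by fact
  interpret BQ: pair_prob_space B Q ..
  interpret QBQ: pair_prob_space Q "B \<Otimes>\<^sub>M Q" ..
  interpret \<Pi>: pair_prob_space A "Q \<Otimes>\<^sub>M (B \<Otimes>\<^sub>M Q)" ..
  let ?\<Pi> = "A \<Otimes>\<^sub>M (Q \<Otimes>\<^sub>M (B \<Otimes>\<^sub>M Q))"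
  \<comment> \<open>Convolution powers add the new factor in front. With these exchanges all four
    terms become events of one product measure with \<open>u\<close>, \<open>v\<close>,
    \<open>x\<close>, \<open>w\<close> in their order in time: \<open>u + v\<close> has law
    \<open>convolution A Q\<close>, and \<open>x + w\<close> has law
    \<open>convolution B Q\<close>.\<close>
  have comm: "convolution Q A = convolution A Q" "convolution Q B = convolution B Q"
    by (auto intro!: convolution_commutative Q.finite_measure_axioms A.finite_measure_axioms B.finite_measure_axioms)
  have nested: "ennreal (measure ?\<Pi> {(u, v, x, w). R u v x w}) =
      (\<integral>\<^sup>+u. \<integral>\<^sup>+v. \<integral>\<^sup>+x. \<integral>\<^sup>+w. indicator {(u, v, x, w). R u v x w} (u, v, x, w) \<partial>Q \<partial>B \<partial>Q \<partial>A)"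
    if [measurable]: "{(u, v, x, w). R u v x w} \<in> sets (borel \<Otimes>\<^sub>M (borel \<Otimes>\<^sub>M (borel \<Otimes>\<^sub>M borel)))" for R
  proof -
    let ?S = "{(u, v, x, w). R u v x w}"
    have S[measurable]: "?S \<in> sets ?\<Pi>"
      using that by simp
    have "ennreal (measure ?\<Pi> ?S) = (\<integral>\<^sup>+z. indicator ?S z \<partial>?\<Pi>)"
      by (subst nn_integral_indicator[OF S]) (rule \<Pi>.emeasure_eq_measure[symmetric])
    also have "\<dots> = (\<integral>\<^sup>+u. \<integral>\<^sup>+z. indicator ?S (u, z) \<partial>(Q \<Otimes>\<^sub>M (B \<Otimes>\<^sub>M Q)) \<partial>A)"
      by (subst QBQ.P.nn_integral_fst) auto
    also have "\<dots> = (\<integral>\<^sup>+u. \<integral>\<^sup>+v. \<integral>\<^sup>+z. indicator ?S (u, v, z) \<partial>(B \<Otimes>\<^sub>M Q) \<partial>Q \<partial>A)"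
      by (subst BQ.P.nn_integral_fst[symmetric]) auto
    also have "\<dots> = (\<integral>\<^sup>+u. \<integral>\<^sup>+v. \<integral>\<^sup>+x. \<integral>\<^sup>+w. indicator ?S (u, v, x, w) \<partial>Q \<partial>B \<partial>Q \<partial>A)"
      by (subst Q.nn_integral_fst[symmetric]) auto
    finally show ?thesis .
  qed
  have joint: "joint_prob L L' a b = measure ?\<Pi> {(u, v, x, w). R u v x w}"
    if "nonneg_law L" "nonneg_law L'"
      and "{(u, v, x, w). R u v x w} \<in> sets (borel \<Otimes>\<^sub>M (borel \<Otimes>\<^sub>M (borel \<Otimes>\<^sub>M borel)))"
      and "(\<integral>\<^sup>+u. \<integral>\<^sup>+v. indicator {(u, v). u \<le> a \<and> u + v \<le> b} (u, v) \<partial>L' \<partial>L) =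
        (\<integral>\<^sup>+u. \<integral>\<^sup>+v. \<integral>\<^sup>+x. \<integral>\<^sup>+w. indicator {(u, v, x, w). R u v x w} (u, v, x, w) \<partial>Q \<partial>B \<partial>Q \<partial>A)"
    for L L' R
    using trans[OF ennreal_joint_prob[OF that(1,2)] trans[OF that(4) nested[OF that(3), symmetric]]]
    unfolding joint_prob_def by (rule iffD1[OF ennreal_inj[OF measure_nonneg measure_nonneg]])
  have sets4:
    "{(u, v, x, w). u \<le> a \<and> u + (v + x) \<le> b} \<in> sets (borel \<Otimes>\<^sub>M (borel \<Otimes>\<^sub>M (borel \<Otimes>\<^sub>M (borel :: real measure))))"
    "{(u, v, x, w). u + v \<le> a \<and> u + v + x \<le> b} \<in> sets (borel \<Otimes>\<^sub>M (borel \<Otimes>\<^sub>M (borel \<Otimes>\<^sub>M (borel :: real measure))))"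
    "{(u, v, x, w). u \<le> a \<and> u + (v + (x + w)) \<le> b} \<in> sets (borel \<Otimes>\<^sub>M (borel \<Otimes>\<^sub>M (borel \<Otimes>\<^sub>M (borel :: real measure))))"
    "{(u, v, x, w). u + v \<le> a \<and> u + v + (x + w) \<le> b} \<in> sets (borel \<Otimes>\<^sub>M (borel \<Otimes>\<^sub>M (borel \<Otimes>\<^sub>M (borel :: real measure))))"
    "{(u, v, x, w). u \<le> a \<and> a < u + v \<and> u + v + x \<le> b \<and> b < u + v + x + w} \<in> sets (borel \<Otimes>\<^sub>M (borel \<Otimes>\<^sub>M (borel \<Otimes>\<^sub>M (borel :: real measure))))"
    by (rule Collect_in_sets, measurable, simp add: space_pair_measure)+
  have J1: "joint_prob A (convolution Q B) a b = measure ?\<Pi> {(u, v, x, w). u \<le> a \<and> u + (v + x) \<le> b}"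
    by (rule joint[OF _ _ sets4(1)])
      (auto simp: AB nn_integral_convolution Q.finite_measure_axioms A.finite_measure_axioms B.finite_measure_axioms
        convolution_finite Q.emeasure_space_1[simplified] intro!: nn_integral_cong split: split_indicator)
  have J2: "joint_prob (convolution A Q) B a b = measure ?\<Pi> {(u, v, x, w). u + v \<le> a \<and> u + v + x \<le> b}"
    by (rule joint[OF _ _ sets4(2)])
      (auto simp: AB nn_integral_convolution Q.finite_measure_axioms A.finite_measure_axioms B.finite_measure_axioms
        convolution_finite Q.emeasure_space_1[simplified] intro!: nn_integral_cong split: split_indicator)
  have J3: "joint_prob A (convolution Q (convolution B Q)) a b = measure ?\<Pi> {(u, v, x, w). u \<le> a \<and> u + (v + (x + w)) \<le> b}"
    by (rule joint[OF _ _ sets4(3)])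
      (auto simp: AB nn_integral_convolution Q.finite_measure_axioms A.finite_measure_axioms B.finite_measure_axioms
        convolution_finite Q.emeasure_space_1[simplified] intro!: nn_integral_cong split: split_indicator)
  have J4: "joint_prob (convolution A Q) (convolution B Q) a b = measure ?\<Pi> {(u, v, x, w). u + v \<le> a \<and> u + v + (x + w) \<le> b}"
    by (rule joint[OF _ _ sets4(4)])
      (auto simp: AB nn_integral_convolution Q.finite_measure_axioms A.finite_measure_axioms B.finite_measure_axioms
        convolution_finite Q.emeasure_space_1[simplified] intro!: nn_integral_cong split: split_indicator)
  let ?S = "{(u, v, x, w). u \<le> a \<and> a < u + v \<and> u + v + x \<le> b \<and> b < u + v + x + w}"
  have AE_nonneg: "AE z in ?\<Pi>. case z of (u, v, x, w) \<Rightarrow> 0 \<le> v \<and> 0 \<le> x \<and> 0 \<le> w"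
  proof (rule \<Pi>.AE_pair_measure)
    have "AE z in B \<Otimes>\<^sub>M Q. case z of (x, w) \<Rightarrow> 0 \<le> x \<and> 0 \<le> w"
    proof (rule BQ.AE_pair_measure)
      show "AE x in B. AE w in Q. case (x, w) of (x, w) \<Rightarrow> 0 \<le> x \<and> 0 \<le> w"
        using B.nonneg by eventually_elim (use Q.nonneg in simp)
    qed measurable
    note 1 = this
    have "AE z in Q \<Otimes>\<^sub>M (B \<Otimes>\<^sub>M Q). case z of (v, x, w) \<Rightarrow> 0 \<le> v \<and> 0 \<le> x \<and> 0 \<le> w"
    proof (rule QBQ.AE_pair_measure)
      show "AE v in Q. AE z in B \<Otimes>\<^sub>M Q. case (v, z) of (v, x, w) \<Rightarrow> 0 \<le> v \<and> 0 \<le> x \<and> 0 \<le> w"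
        using Q.nonneg by eventually_elim (use 1 in \<open>auto simp: case_prod_beta'\<close>)
    qed measurable
    then show "AE u in A. AE z in Q \<Otimes>\<^sub>M (B \<Otimes>\<^sub>M Q). case (u, z) of (u, v, x, w) \<Rightarrow> 0 \<le> v \<and> 0 \<le> x \<and> 0 \<le> w"
      by simp
  qed measurable
  let ?S1 = "{(u, v, x, w). u \<le> a \<and> u + (v + x) \<le> b}"
  let ?S2 = "{(u, v, x, w). u + v \<le> a \<and> u + v + x \<le> b}"
  let ?S3 = "{(u, v, x, w). u \<le> a \<and> u + (v + (x + w)) \<le> b}"
  let ?S4 = "{(u, v, x, w). u + v \<le> a \<and> u + v + (x + w) \<le> b}"
  have sets_\<Pi>: "?S1 \<in> sets ?\<Pi>" "?S2 \<in> sets ?\<Pi>" "?S3 \<in> sets ?\<Pi>" "?S4 \<in> sets ?\<Pi>" "?S \<in> sets ?\<Pi>"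
    using sets4 by simp_all
  \<comment> \<open>As \<open>v\<close> and \<open>w\<close> are almost surely nonnegative,
    \<open>?S2\<close> and \<open>?S3\<close> lie in \<open>?S1\<close> and meet in
    \<open>?S4\<close>, while \<open>?S\<close> is \<open>?S1\<close> without their union. Inclusion
    and exclusion is arranged here so that both sides are sums.\<close>
  have "(\<integral>z. indicator ?S z + indicator ?S2 z + (indicator ?S3 z :: real) \<partial>?\<Pi>)
      = (\<integral>z. indicator ?S1 z + indicator ?S4 z \<partial>?\<Pi>)"
  proof (rule integral_cong_AE)
    show "AE z in ?\<Pi>. indicator ?S z + indicator ?S2 z + (indicator ?S3 z :: real) = indicator ?S1 z + indicator ?S4 z"
      using AE_nonneg by eventually_elim (use \<open>a \<le> b\<close> in \<open>auto split: split_indicator\<close>)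
  qed (use sets_\<Pi> in measurable)
  then have "measure ?\<Pi> ?S + measure ?\<Pi> ?S2 + measure ?\<Pi> ?S3 = measure ?\<Pi> ?S1 + measure ?\<Pi> ?S4"
    using sets_\<Pi> by (simp add: \<Pi>.emeasure_eq_measure space_pair_measure)
  moreover have "renewal_prob Q m (m + 1 + k) a b
      = joint_prob A (convolution Q B) a b - joint_prob (convolution A Q) B a b
        - joint_prob A (convolution Q (convolution B Q)) a b + joint_prob (convolution A Q) (convolution B Q) a b"
    unfolding renewal_prob_def comm(1)[symmetric] unfolding comm(2)[symmetric] by (simp add: A_def B_def)
  ultimately have "measure ?\<Pi> ?S = renewal_prob Q m (m + 1 + k) a b"
    unfolding J1 J2 J3 J4 by simp
  moreover have "measure ?\<Pi> ?S = (\<integral>u. indicator {..a} u * (\<integral>v. indicator {a - u<..b - u} v *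
      (\<integral>x. indicator {..b - (u + v)} x * measure Q {b - u - v - x<..} \<partial>B) \<partial>Q) \<partial>A)"
  proof (subst A.measure_pair_eq_integral[OF QBQ.P.prob_space_axioms sets_\<Pi>(5)], intro Bochner_Integration.integral_cong refl)
    fix u
    show "measure (Q \<Otimes>\<^sub>M (B \<Otimes>\<^sub>M Q)) (Pair u -` ?S) = indicator {..a} u * (\<integral>v. indicator {a - u<..b - u} v *
      (\<integral>x. indicator {..b - (u + v)} x * measure Q {b - u - v - x<..} \<partial>B) \<partial>Q)"
    proof (cases "u \<le> a")
      case True
      let ?T = "{(v, x, w). a < u + v \<and> u + v + x \<le> b \<and> b < u + v + x + w}"
      have T: "?T \<in> sets (borel \<Otimes>\<^sub>M (borel \<Otimes>\<^sub>M borel))"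
        by (rule Collect_in_sets, measurable, simp add: space_pair_measure)
      have eq: "Pair u -` ?S = ?T" using True by auto
      have "measure (Q \<Otimes>\<^sub>M (B \<Otimes>\<^sub>M Q)) ?T = (\<integral>v. indicator {a - u<..b - u} v *
        (\<integral>x. indicator {..b - (u + v)} x * measure Q {b - u - v - x<..} \<partial>B) \<partial>Q)"
      proof (subst Q.measure_pair_eq_integral[OF BQ.P.prob_space_axioms])
        show "?T \<in> sets (Q \<Otimes>\<^sub>M (B \<Otimes>\<^sub>M Q))" using T by simp
        show "(\<integral>v. measure (B \<Otimes>\<^sub>M Q) (Pair v -` ?T) \<partial>Q) = (\<integral>v. indicator {a - u<..b - u} v *
          (\<integral>x. indicator {..b - (u + v)} x * measure Q {b - u - v - x<..} \<partial>B) \<partial>Q)"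
        proof (intro Bochner_Integration.integral_cong refl)
          fix v
          show "measure (B \<Otimes>\<^sub>M Q) (Pair v -` ?T) = indicator {a - u<..b - u} v *
            (\<integral>x. indicator {..b - (u + v)} x * measure Q {b - u - v - x<..} \<partial>B)"
          proof (cases "a < u + v")
            case True
            let ?U = "{(x, w). u + v + x \<le> b \<and> b < u + v + x + w}"
            have U: "?U \<in> sets (borel \<Otimes>\<^sub>M borel)"
              by (rule Collect_in_sets, measurable, simp add: space_pair_measure)
            have "measure (B \<Otimes>\<^sub>M Q) ?U = (\<integral>x. measure Q (Pair x -` ?U) \<partial>B)"
              by (rule B.measure_pair_eq_integral[OF Q.prob_space_axioms]) (use U in simp)
            also have "\<dots> = (\<integral>x. indicator {..b - (u + v)} x * measure Q {b - u - v - x<..} \<partial>B)"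
            proof (intro Bochner_Integration.integral_cong refl)
              fix x
              have "Pair x -` ?U = (if x \<le> b - (u + v) then {b - u - v - x<..} else {})" by auto
              then show "measure Q (Pair x -` ?U) = indicator {..b - (u + v)} x * measure Q {b - u - v - x<..}"
                by simp
            qed
            finally have "measure (B \<Otimes>\<^sub>M Q) (Pair v -` ?T)
                = (\<integral>x. indicator {..b - (u + v)} x * measure Q {b - u - v - x<..} \<partial>B)"
              using True by (simp add: vimage_def)
            \<comment> \<open>The upper bound \<open>v \<le> b - u\<close> can be added to the
              indicator: beyond it no nonnegative \<open>x\<close> is left.\<close>
            moreover have "(\<integral>x. indicator {..b - (u + v)} x * measure Q {b - u - v - x<..} \<partial>B) = 0" if "\<not> u + v \<le> b"
            proof (rule integral_eq_zero_AE)
              show "AE x in B. indicator {..b - (u + v)} x * measure Q {b - u - v - x<..} = 0"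
                using B.nonneg by eventually_elim (use that in simp)
            qed
            moreover have "v \<in> {a - u<..b - u} \<longleftrightarrow> u + v \<le> b"
              using True by auto
            ultimately show ?thesis by (cases "u + v \<le> b") simp_all
          next
            case False
            then have "Pair v -` ?T = {}" by auto
            then show ?thesis using False by simp
          qed
        qed
      qed
      then show ?thesis using True eq by simp
    next
      case False
      then have "Pair u -` ?S = {}" by auto
      then show ?thesis using False by simp
    qed
  qed
  ultimately show ?thesis by (simp add: A_def B_def)
qed

lemma joint_prob_return:
  assumes "nonneg_law P" "a \<le> b"
  shows "joint_prob P (return borel 0) a b = measure P {..a}"
proof -
  interpret P: nonneg_law P by fact
  interpret R: nonneg_law "return borel (0::real)" by (rule nonneg_law_return) simp
  have [measurable]: "{(u, v). u \<le> a \<and> u + v \<le> b} \<in> sets (borel \<Otimes>\<^sub>M borel)"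
    by (rule joint_set_borel)
  have "joint_prob P (return borel 0) a b = (\<integral>u. indicator {..a} u \<partial>P)"
    unfolding joint_prob_def
  proof (subst P.measure_pair_eq_integral[OF R.prob_space_axioms], simp, intro Bochner_Integration.integral_cong refl)
    fix u
    have "Pair u -` {(u, v). u \<le> a \<and> u + v \<le> b} = (if u \<le> a then {..b - u} else {})" by auto
    then show "measure (return borel 0) (Pair u -` {(u, v). u \<le> a \<and> u + v \<le> b}) = indicator {..a} u"
      using \<open>a \<le> b\<close> by (simp add: measure_return)
  qed
  then show ?thesis by simp
qed

text \<open>With \<open>T_i\<close> the arrival times, after the cancellation the probability of
  \<open>T_m \<le> a\<close> minus that of \<open>T_m \<le> a\<close>,
  \<open>T_{m+1} \<le> b\<close> is left. The power with exponent \<open>Suc 0\<close> carries a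
  convolution with the point mass at 0, removed by uniqueness of Laplace transforms.\<close>

lemma renewal_prob_no_jump:
  assumes Q: "nonneg_law Q" and "a \<le> b"
  shows "renewal_prob Q m m a b =
    (\<integral>u. indicator {..a} u * measure Q {b - u<..} \<partial>convolution_power Q m)"
proof -
  define A where "A = convolution_power Q m"
  have A: "nonneg_law A"
    unfolding A_def by (rule nonneg_law_convolution_power[OF Q])
  have Q_return: "convolution Q (return borel 0) = Q"
  proof (rule laplace_transform_unique)
    show "nonneg_law (convolution Q (return borel 0))" "nonneg_law Q"
      by (simp_all add: Q nonneg_law_convolution nonneg_law_return)
    show "laplace_transform (convolution Q (return borel 0)) x = laplace_transform Q x" for x
      by (simp add: Q laplace_transform_convolution laplace_transform_return nonneg_law_return)
  qed
  interpret Q: nonneg_law Q by fact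
  interpret A: nonneg_law A by fact
  interpret AQ: pair_prob_space A Q ..
  have [measurable]: "{(u, v). u \<le> a \<and> u + v \<le> b} \<in> sets (borel \<Otimes>\<^sub>M borel)"
    by (rule joint_set_borel)
  have 0: "joint_prob A (return borel 0) a b = (\<integral>u. indicator {..a} u \<partial>A)"
    using joint_prob_return[OF A \<open>a \<le> b\<close>] by simp
  have 1: "joint_prob A Q a b = (\<integral>u. indicator {..a} u * measure Q {..b - u} \<partial>A)"
    unfolding joint_prob_def
  proof (subst A.measure_pair_eq_integral[OF Q.prob_space_axioms], simp, intro Bochner_Integration.integral_cong refl)
    fix u
    have "Pair u -` {(u, v). u \<le> a \<and> u + v \<le> b} = (if u \<le> a then {..b - u} else {})" by auto
    then show "measure Q (Pair u -` {(u, v). u \<le> a \<and> u + v \<le> b}) = indicator {..a} u * measure Q {..b - u}"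
      by simp
  qed
  have meas: "(\<lambda>u. measure Q {..b - u}) \<in> borel_measurable borel"
    by (rule measurable_compose[OF _ Q.cdf_measurable]) simp
  have "renewal_prob Q m m a b = joint_prob A (return borel 0) a b - joint_prob A Q a b"
    by (simp add: renewal_prob_def A_def Q_return)
  also have "\<dots> = (\<integral>u. indicator {..a} u - indicator {..a} u * measure Q {..b - u} \<partial>A)"
    unfolding 0 1
  proof (rule Bochner_Integration.integral_diff[symmetric])
    show "integrable A (indicator {..a} :: real \<Rightarrow> real)"
      by (rule A.integrable_const_bound[where B=1]) (auto simp: indicator_def)
    show "integrable A (\<lambda>u. indicator {..a} u * measure Q {..b - u})"
    proof (rule A.integrable_const_bound[where B=1])
      show "(\<lambda>u. indicator {..a} u * measure Q {..b - u}) \<in> borel_measurable A"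
        using borel_measurable_times[OF borel_measurable_indicator meas, of "{..a}"]
        by (simp add: measurable_cong_sets[OF A.sets_P refl])
    qed (simp add: indicator_def)
  qed
  also have "\<dots> = (\<integral>u. indicator {..a} u * measure Q {b - u<..} \<partial>A)"
    by (intro Bochner_Integration.integral_cong refl) (simp add: Q.measure_greaterThan right_diff_distrib)
  finally show ?thesis by (simp add: A_def)
qed

subsection \<open>Subordinators and their inverses\<close>

lemma inverse_process_le: "0 \<le> r \<Longrightarrow> s < D r \<omega> \<Longrightarrow> inverse_process D s \<omega> \<le> r"
  unfolding inverse_process_def by (rule cInf_lower) (auto intro: bdd_belowI[of _ 0])

context
  fixes D :: "real \<Rightarrow> 'w \<Rightarrow> real" and \<omega>
  assumes unbounded: "\<forall>s. \<exists>r\<ge>0. s < D r \<omega>"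
begin

text \<open>The assumption of the context keeps the set under \<open>Inf\<close> nonempty, so that
  \<open>Inf\<close> is a true infimum; \<open>D_unbounded\<close> supplies it almost
  surely.\<close>

lemma inverse_process_lessD: "inverse_process D s \<omega> < q \<Longrightarrow> \<exists>r\<ge>0. r < q \<and> s < D r \<omega>"
  unfolding inverse_process_def using unbounded by (auto dest!: cInf_lessD[rotated])

lemma inverse_process_nonneg: "0 \<le> inverse_process D s \<omega>"
  unfolding inverse_process_def using unbounded by (intro cInf_greatest) auto

lemma inverse_process_mono: "s \<le> t \<Longrightarrow> inverse_process D s \<omega> \<le> inverse_process D t \<omega>"
  unfolding inverse_process_def using unbounded
  by (intro cInf_superset_mono) (auto intro: bdd_belowI[of _ 0])

text \<open>The strict inequality in the first-passage definition is the reason: a time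
  \<open>r\<close> just above the infimum with \<open>s < D r \<omega>\<close> bounds the inverse at
  every \<open>t\<close> in the open interval from \<open>s\<close> to
  \<open>D r \<omega>\<close>.\<close>

lemma inverse_process_right_continuous:
  "((\<lambda>s. inverse_process D s \<omega>) \<longlongrightarrow> inverse_process D s \<omega>) (at_right s)"
proof (rule tendstoI)
  fix e :: real assume "0 < e"
  then obtain r where r: "0 \<le> r" "r < inverse_process D s \<omega> + e" "s < D r \<omega>"
    using inverse_process_lessD[of s "inverse_process D s \<omega> + e"] by auto
  show "\<forall>\<^sub>F t in at_right s. dist (inverse_process D t \<omega>) (inverse_process D s \<omega>) < e"
    unfolding eventually_at_right_field
  proof (intro exI[of _ "D r \<omega>"] conjI allI impI r(3))
    fix t assume "s < t" "t < D r \<omega>"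
    then have "inverse_process D s \<omega> \<le> inverse_process D t \<omega>" "inverse_process D t \<omega> \<le> r"
      using r(1) by (auto intro: inverse_process_mono inverse_process_le)
    then show "dist (inverse_process D t \<omega>) (inverse_process D s \<omega>) < e"
      using r(2) by (simp add: dist_real_def)
  qed
qed

end

lemma emeasure_completion_sets: "S \<in> sets M \<Longrightarrow> emeasure (completion M) S = emeasure M S"
  by simp

lemma (in prob_space) indep_vars_pair:
  fixes X :: "nat \<Rightarrow> 'a \<Rightarrow> real"
  assumes "indep_vars (\<lambda>_. borel) X {..<2}" and A: "A \<in> sets borel" "B \<in> sets borel"
  shows "emeasure M (X 0 -` A \<inter> X 1 -` B \<inter> space M) = emeasure M (X 0 -` A \<inter> space M) * emeasure M (X 1 -` B \<inter> space M)"
proof -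
  have 2: "{..<2::nat} = {0, 1}" by auto
  have "prob (\<Inter>i\<in>{..<2}. X i -` (if i = 0 then A else B) \<inter> space M)
      = (\<Prod>i\<in>{..<2}. prob (X i -` (if i = 0 then A else B) \<inter> space M))"
    by (rule indep_varsD_finite[OF assms(1)]) (use A in \<open>auto simp: 2\<close>)
  moreover have "(X 0 -` A \<inter> space M) \<inter> (X 1 -` B \<inter> space M) = X 0 -` A \<inter> X 1 -` B \<inter> space M" by auto
  ultimately show ?thesis
    by (simp add: 2 emeasure_eq_measure flip: ennreal_mult)
qed

text \<open>One positive value of the exponent excludes the zero process; this makes the paths
  unbounded and the first-passage times finite. The exponents \<open>x powr \<beta>\<close>,
  \<open>f\<close> and \<open>\<phi>\<close> all qualify.\<close>

locale unbounded_subordinator = prob_space M for M :: "'w measure" +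
  fixes D :: "real \<Rightarrow> 'w \<Rightarrow> real" and \<psi> :: "real \<Rightarrow> real"
  assumes subordinator: "subordinator M \<psi> D"
    and exponent_pos: "\<exists>x>0. 0 < \<psi> x"
begin

abbreviation E :: "real \<Rightarrow> 'w \<Rightarrow> real" where "E \<equiv> inverse_process D"

text \<open>Constant on negative arguments, so that it is a kernel on the whole line. For a law
  \<open>P\<close> on the half-line, \<open>P \<bind> K\<close> is the law of \<open>D\<close> at an
  independent random time with law \<open>P\<close>.\<close>

definition K :: "real \<Rightarrow> real measure" where "K r = distr M borel (D (max 0 r))"

lemma measurable_D [measurable]: "0 \<le> r \<Longrightarrow> D r \<in> borel_measurable M"
  and D_0: "AE \<omega> in M. D 0 \<omega> = 0"
  and D_mono: "AE \<omega> in M. mono_on {0..} (\<lambda>r. D r \<omega>)"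
  and laplace_D: "0 \<le> r \<Longrightarrow> 0 < x \<Longrightarrow> (\<integral>\<omega>. exp (- x * D r \<omega>) \<partial>M) = exp (- r * \<psi> x)"
  and D_indep: "independent_increments M D"
  and D_stationary: "stationary_increments M D"
  using subordinator unfolding subordinator_def levy_process_def by auto

lemma D_nonneg: "0 \<le> r \<Longrightarrow> AE \<omega> in M. 0 \<le> D r \<omega>"
  using D_0 D_mono by eventually_elim (metis atLeast_iff mono_onD order_refl)

lemma nonneg_law_K: "nonneg_law (K r)"
  unfolding K_def by (rule nonneg_law_distr[OF prob_space_axioms]) (auto intro: D_nonneg)

lemma integrable_exp_D: "0 \<le> r \<Longrightarrow> 0 < x \<Longrightarrow> integrable M (\<lambda>\<omega>. exp (- x * D r \<omega>))"
  by (rule integrable_const_bound[where B=1]) (use D_nonneg[of r] in \<open>auto elim!: eventually_mono\<close>)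

lemma laplace_transform_K:
  assumes "0 \<le> r" "0 < x"
  shows "laplace_transform (K r) x = ennreal (exp (- r * \<psi> x))"
proof -
  have "laplace_transform (K r) x = (\<integral>\<^sup>+\<omega>. ennreal (exp (- x * D r \<omega>)) \<partial>M)"
    using assms by (simp add: laplace_transform_def K_def nn_integral_distr)
  also have "\<dots> = ennreal (\<integral>\<omega>. exp (- x * D r \<omega>) \<partial>M)"
    by (rule nn_integral_eq_integral) (use integrable_exp_D[OF assms] in auto)
  finally show ?thesis using laplace_D[OF assms] by simp
qed

text \<open>Half-lines generate the Borel sets, and the probability of \<open>D r \<le> a\<close> is
  nonincreasing in \<open>r\<close> because paths are nondecreasing; monotone functions are Borel.
  The signs only turn antitone into monotone.\<close>

lemma measurable_K [measurable]: "K \<in> borel \<rightarrow>\<^sub>M prob_algebra borel"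
proof (rule measurable_prob_algebra_generated)
  show "sets borel = sigma_sets UNIV (range (\<lambda>a::real. {..a}))"
    by (subst borel_eq_atMost) (simp add: sets_measure_of)
  show "Int_stable (range (\<lambda>a::real. {..a}))"
    by (auto simp: Int_stable_def)
  show "prob_space (K r)" "sets (K r) = sets borel" for r
    using nonneg_law_K[of r] by (simp_all add: nonneg_law_def nonneg_law_axioms_def)
  fix A assume "A \<in> range (\<lambda>a::real. {..a})"
  then obtain a where A: "A = {..a}" by auto
  have "mono (\<lambda>r. - prob {\<omega> \<in> space M. D (max 0 r) \<omega> \<le> a})"
  proof (rule monoI)
    fix q r :: real assume "q \<le> r"
    have "prob {\<omega> \<in> space M. D (max 0 r) \<omega> \<le> a} \<le> prob {\<omega> \<in> space M. D (max 0 q) \<omega> \<le> a}"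
    proof (intro finite_measure_mono_AE)
      show "AE \<omega> in M. \<omega> \<in> {\<omega> \<in> space M. D (max 0 r) \<omega> \<le> a} \<longrightarrow> \<omega> \<in> {\<omega> \<in> space M. D (max 0 q) \<omega> \<le> a}"
        using D_mono
      proof eventually_elim
        case (elim \<omega>)
        have "D (max 0 q) \<omega> \<le> D (max 0 r) \<omega>"
          by (rule mono_onD[OF elim]) (use \<open>q \<le> r\<close> in auto)
        then show ?case by auto
      qed
    qed measurable
    then show "- prob {\<omega> \<in> space M. D (max 0 q) \<omega> \<le> a} \<le> - prob {\<omega> \<in> space M. D (max 0 r) \<omega> \<le> a}" by simp
  qed
  then have "(\<lambda>r. - (- prob {\<omega> \<in> space M. D (max 0 r) \<omega> \<le> a})) \<in> borel_measurable borel"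
    by (intro borel_measurable_uminus borel_measurable_mono)
  then have "(\<lambda>r. ennreal (prob {\<omega> \<in> space M. D (max 0 r) \<omega> \<le> a})) \<in> borel_measurable borel"
    by simp
  moreover have "emeasure (K r) A = ennreal (prob {\<omega> \<in> space M. D (max 0 r) \<omega> \<le> a})" for r
    by (simp add: A K_def emeasure_distr vimage_def Int_def conj_commute flip: emeasure_eq_measure)
  ultimately show "(\<lambda>r. emeasure (K r) A) \<in> borel_measurable borel" by simp
qed auto

lemma measurable_K_subprob [measurable]: "K \<in> borel \<rightarrow>\<^sub>M subprob_algebra borel"
  by (rule measurable_prob_algebraD) measurable

text \<open>A Chernoff bound: where \<open>D\<close> stays below \<open>k\<close> at all integers,
  \<open>exp (- x * D n)\<close> is at least \<open>exp (- x * k)\<close>, while its expectation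
  \<open>exp (- n * \<psi> x)\<close> tends to 0.\<close>

lemma D_unbounded: "AE \<omega> in M. \<forall>s. \<exists>r\<ge>0. s < D r \<omega>"
proof -
  obtain x where x: "0 < x" "0 < \<psi> x" using exponent_pos by auto
  have "AE \<omega> in M. \<exists>n::nat. real k < D (real n) \<omega>" for k :: nat
  proof -
    let ?A = "{\<omega> \<in> space M. \<forall>n::nat. D (real n) \<omega> \<le> real k}"
    have A[measurable]: "?A \<in> sets M" by measurable
    have "exp (- x * real k) * prob ?A \<le> exp (- real n * \<psi> x)" for n
    proof -
      have "(\<integral>\<omega>. exp (- x * real k) * indicator ?A \<omega> \<partial>M) \<le> (\<integral>\<omega>. exp (- x * D (real n) \<omega>) \<partial>M)"
        by (rule integral_mono) (use x integrable_exp_D[of n x] in \<open>auto split: split_indicator simp: less_top[symmetric]\<close>)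
      then show ?thesis using laplace_D[of n x] x A sets.sets_into_space[OF A] by (simp add: Int_absorb2)
    qed
    moreover have "(\<lambda>n. exp (- real n * \<psi> x)) \<longlonglongrightarrow> 0"
      using x by real_asymp
    ultimately have "exp (- x * real k) * prob ?A \<le> 0"
      by (intro LIMSEQ_le_const) auto
    then have "prob ?A = 0"
      using measure_nonneg[of M ?A] by (simp add: mult_le_0_iff)
    then have "AE \<omega> in M. \<omega> \<notin> ?A" by (simp add: prob_eq_0)
    then show ?thesis by (rule AE_mp) (auto intro!: AE_I2 simp: not_le)
  qed
  then have "AE \<omega> in M. \<forall>k::nat. \<exists>n::nat. real k < D (real n) \<omega>" by (simp add: AE_all_countable)
  then show ?thesis
  proof eventually_elim
    case (elim \<omega>)
    show ?case
    proof
      fix s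
      obtain k :: nat where "s \<le> real k" using real_arch_simple by blast
      then show "\<exists>r\<ge>0. s < D r \<omega>" using elim by (meson le_less_trans of_nat_0_le_iff)
    qed
  qed
qed

text \<open>The times \<open>q k\<close> tend to \<open>r\<close> from below. On the exceptional
  event \<open>?A\<close>, where \<open>D\<close> stays at most \<open>s\<close> along them but
  exceeds \<open>s\<close> at \<open>r\<close>, the difference of \<open>exp (- x * D (q k))\<close>
  and \<open>exp (- x * D r)\<close> is at least the positive \<open>?g\<close>. Its expectation
  tends to 0 since the Laplace transform is continuous in time.\<close>

lemma no_fixed_jump:
  assumes "0 < r" "0 \<le> s"
  shows "AE \<omega> in M. s < D r \<omega> \<longrightarrow> (\<exists>q\<ge>0. q < r \<and> s < D q \<omega>)"
proof -
  obtain x where x: "0 < x" "0 < \<psi> x" using exponent_pos by auto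
  define q where "q k = r * (1 - 1 / real (k + 2))" for k
  have q: "0 \<le> q k" "q k < r" for k
    using assms by (auto simp: q_def field_simps)
  let ?A = "{\<omega> \<in> space M. (\<forall>k. D (q k) \<omega> \<le> s) \<and> s < D r \<omega>}"
  let ?g = "\<lambda>\<omega>. indicator ?A \<omega> * (exp (- x * s) - exp (- x * D r \<omega>))"
  have meas[measurable]: "D (q k) \<in> borel_measurable M" "D r \<in> borel_measurable M" for k
    using q assms by auto
  have A: "?A \<in> sets M" by measurable
  have g_nonneg: "0 \<le> ?g \<omega>" for \<omega>
    using x by (auto split: split_indicator)
  have g_bound: "AE \<omega> in M. ?g \<omega> \<le> exp (- x * D (q k) \<omega>) - exp (- x * D r \<omega>)" for k
    using D_mono
  proof eventually_elim
    case (elim \<omega>)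
    have "D (q k) \<omega> \<le> D r \<omega>"
      using mono_onD[OF elim, of "q k" r] q[of k] by simp
    then show ?case using x by (auto split: split_indicator)
  qed
  have g_int: "integrable M ?g"
  proof (rule integrable_const_bound[where B=1])
    show "AE \<omega> in M. norm (?g \<omega>) \<le> 1"
    proof (rule AE_I2)
      fix \<omega>
      have "?g \<omega> \<le> exp (- x * s)" by (simp split: split_indicator)
      also have "\<dots> \<le> 1" using x assms by simp
      finally show "norm (?g \<omega>) \<le> 1" using g_nonneg[of \<omega>] by (simp only: real_norm_def abs_of_nonneg)
    qed
  qed (use A in measurable)
  have "(\<integral>\<omega>. ?g \<omega> \<partial>M) \<le> exp (- q k * \<psi> x) - exp (- r * \<psi> x)" for k
  proof -
    have "(\<integral>\<omega>. ?g \<omega> \<partial>M) \<le> (\<integral>\<omega>. exp (- x * D (q k) \<omega>) - exp (- x * D r \<omega>) \<partial>M)"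
      by (rule integral_mono_AE[OF g_int _ g_bound])
         (use integrable_exp_D[OF q(1) x(1)] integrable_exp_D[of r x] assms x in auto)
    also have "\<dots> = exp (- q k * \<psi> x) - exp (- r * \<psi> x)"
      using integrable_exp_D[OF q(1) x(1), of k] integrable_exp_D[of r x] assms x
        laplace_D[OF q(1) x(1), of k] laplace_D[of r x] by simp
    finally show ?thesis .
  qed
  moreover have "(\<lambda>k. exp (- q k * \<psi> x) - exp (- r * \<psi> x)) \<longlonglongrightarrow> 0"
    unfolding q_def by real_asymp
  ultimately have "(\<integral>\<omega>. ?g \<omega> \<partial>M) \<le> 0"
    by (intro LIMSEQ_le_const) auto
  then have "(\<integral>\<omega>. ?g \<omega> \<partial>M) = 0"
    using Bochner_Integration.integral_nonneg[of M ?g] g_nonneg by (simp add: order_antisym)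
  then have "AE \<omega> in M. ?g \<omega> = 0"
    using integral_nonneg_eq_0_iff_AE[OF g_int] g_nonneg by simp
  then show ?thesis
    using AE_space
  proof eventually_elim
    case (elim \<omega>)
    show ?case
    proof (intro impI, rule ccontr)
      assume "s < D r \<omega>" "\<not> (\<exists>q\<ge>0. q < r \<and> s < D q \<omega>)"
      moreover from this have "D (q k) \<omega> \<le> s" for k using q[of k] by (meson not_le)
      ultimately have "\<omega> \<in> ?A" using elim(2) by simp
      then have "exp (- x * s) = exp (- x * D r \<omega>)" using elim(1) by simp
      then show False using \<open>s < D r \<omega>\<close> x by simp
    qed
  qed
qed

text \<open>Left to right is monotonicity of the path. Conversely, \<open>no_fixed_jump\<close>
  moves the crossing of level \<open>s\<close> strictly before \<open>r\<close>; there
  \<open>0 < r\<close>, because \<open>D\<close> starts at 0 and \<open>s\<close> is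
  nonnegative.\<close>

lemma passage:
  assumes "0 \<le> s" "0 \<le> r"
  shows "AE \<omega> in M. E s \<omega> < r \<longleftrightarrow> s < D r \<omega>"
proof -
  have "AE \<omega> in M. 0 < r \<longrightarrow> s < D r \<omega> \<longrightarrow> (\<exists>q\<ge>0. q < r \<and> s < D q \<omega>)"
    using no_fixed_jump[of r s] assms by (cases "0 < r") auto
  then show ?thesis
    using D_unbounded D_mono D_0
  proof eventually_elim
    case (elim \<omega>)
    show ?case
    proof
      assume "E s \<omega> < r"
      then obtain q where "0 \<le> q" "q < r" "s < D q \<omega>"
        using inverse_process_lessD[where D=D and \<omega>=\<omega>, OF elim(2)] by blast
      then show "s < D r \<omega>"
        using mono_onD[OF elim(3), of q r] by auto
    next
      assume "s < D r \<omega>"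
      moreover from this have "0 < r" using assms elim(4) by (cases "r = 0") auto
      ultimately obtain q where "0 \<le> q" "q < r" "s < D q \<omega>" using elim(1) by auto
      then show "E s \<omega> < r" using inverse_process_le[of q s D \<omega>] by simp
    qed
  qed
qed

lemma E_nonneg: "AE \<omega> in M. \<forall>s. 0 \<le> E s \<omega>"
  using D_unbounded by eventually_elim (auto intro: inverse_process_nonneg)

lemma E_mono: "AE \<omega> in M. \<forall>s t. s \<le> t \<longrightarrow> E s \<omega> \<le> E t \<omega>"
  using D_unbounded by eventually_elim (auto intro: inverse_process_mono)

lemma E_right_continuous: "AE \<omega> in M. \<forall>s. ((\<lambda>s. E s \<omega>) \<longlongrightarrow> E s \<omega>) (at_right s)"
  using D_unbounded by eventually_elim (auto intro: inverse_process_right_continuous)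

text \<open>By \<open>passage\<close> the event \<open>E s \<omega> < r\<close> differs from an
  event of \<open>M\<close> by a null set, which places it in the completion.\<close>

lemma measurable_E [measurable]:
  assumes "0 \<le> s"
  shows "E s \<in> borel_measurable (completion M)"
proof (subst borel_measurable_iff_less, intro allI)
  fix r
  show "{\<omega> \<in> space (completion M). E s \<omega> < r} \<in> sets (completion M)"
  proof (cases "0 \<le> r")
    case True
    have "AE \<omega> in completion M. \<omega> \<in> {\<omega> \<in> space M. s < D r \<omega>} \<longleftrightarrow> \<omega> \<in> {\<omega> \<in> space M. E s \<omega> < r}"
      using AE_completion[OF passage[OF assms True]] by eventually_elim auto
    moreover have "{\<omega> \<in> space M. s < D r \<omega>} \<in> sets (completion M)"
      using True by (intro sets_completionI_sets) measurable
    ultimately show ?thesis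
      using completion.in_sets_AE[of "{\<omega> \<in> space M. s < D r \<omega>}" "{\<omega> \<in> space M. E s \<omega> < r}" M] by auto
  next
    case False
    have "AE \<omega> in completion M. \<omega> \<in> {} \<longleftrightarrow> \<omega> \<in> {\<omega> \<in> space M. E s \<omega> < r}"
      using AE_completion[OF E_nonneg] by eventually_elim (use False in \<open>auto simp: not_less intro: order_trans[of _ 0]\<close>)
    then show ?thesis
      using completion.in_sets_AE[of "{}" "{\<omega> \<in> space M. E s \<omega> < r}" M] by auto
  qed
qed

text \<open>Independence of the increments over \<open>0\<close>, \<open>u\<close>,
  \<open>u + v\<close>. The first increment is \<open>D u\<close> because \<open>D 0 = 0\<close>
  almost surely; stationarity identifies the law of the second with \<open>K v\<close>.\<close>

lemma joint_law:
  assumes "0 \<le> u" "0 \<le> v"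
  shows "distr M (borel \<Otimes>\<^sub>M borel) (\<lambda>\<omega>. (D u \<omega>, D (u + v) \<omega> - D u \<omega>)) = K u \<Otimes>\<^sub>M K v"
proof -
  define \<tau> :: "nat \<Rightarrow> real" where "\<tau> i = (if i = 0 then 0 else if i = 1 then u else u + v)" for i
  let ?X = "\<lambda>i \<omega>. D (\<tau> (Suc i)) \<omega> - D (\<tau> i) \<omega>"
  have [measurable]: "D 0 \<in> borel_measurable M" "D u \<in> borel_measurable M" "D (u + v) \<in> borel_measurable M"
    using assms by auto
  have "indep_vars (\<lambda>_. borel) ?X {..<2}"
    using D_indep[unfolded independent_increments_def, rule_format, of \<tau> 2] assms by (auto simp: \<tau>_def)
  note indep = indep_vars_pair[OF this]
  have meas[measurable]: "?X 0 \<in> borel_measurable M" "?X 1 \<in> borel_measurable M"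
    by (simp_all add: \<tau>_def)
  have "distr M borel (?X 0) \<Otimes>\<^sub>M distr M borel (?X 1) = distr M (borel \<Otimes>\<^sub>M borel) (\<lambda>\<omega>. (?X 0 \<omega>, ?X 1 \<omega>))"
  proof (rule pair_measure_eqI)
    fix A B assume "A \<in> sets (distr M borel (?X 0))" "B \<in> sets (distr M borel (?X 1))"
    then have AB: "A \<in> sets borel" "B \<in> sets borel" by auto
    have calc: "emeasure (distr M (borel \<Otimes>\<^sub>M borel) (\<lambda>\<omega>. (?X 0 \<omega>, ?X 1 \<omega>))) (A \<times> B)
        = emeasure M (?X 0 -` A \<inter> ?X 1 -` B \<inter> space M)"
      by (subst emeasure_distr) (use AB meas in \<open>auto intro!: arg_cong[where f="emeasure M"]\<close>)
    show "emeasure (distr M borel (?X 0)) A * emeasure (distr M borel (?X 1)) B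
        = emeasure (distr M (borel \<Otimes>\<^sub>M borel) (\<lambda>\<omega>. (?X 0 \<omega>, ?X 1 \<omega>))) (A \<times> B)"
      unfolding calc emeasure_distr[OF meas(1) AB(1)] emeasure_distr[OF meas(2) AB(2)]
      by (rule indep[OF AB, symmetric])
  next
    show "sigma_finite_measure (distr M borel (?X 0))" "sigma_finite_measure (distr M borel (?X 1))"
      by (rule prob_space_imp_sigma_finite[OF prob_space_distr], rule meas)+
  qed simp
  moreover have "distr M borel (?X 0) = K u"
    unfolding K_def using assms D_0 by (intro distr_cong_AE) (auto simp: \<tau>_def)
  moreover have "distr M borel (?X 1) = K v"
    using D_stationary[unfolded stationary_increments_def, rule_format, of u v] assms
    by (simp add: \<tau>_def K_def)
  moreover have "distr M (borel \<Otimes>\<^sub>M borel) (\<lambda>\<omega>. (?X 0 \<omega>, ?X 1 \<omega>))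
      = distr M (borel \<Otimes>\<^sub>M borel) (\<lambda>\<omega>. (D u \<omega>, D (u + v) \<omega> - D u \<omega>))"
    using D_0 by (intro distr_cong_AE) (auto simp: \<tau>_def)
  ultimately show ?thesis by simp
qed

text \<open>The core of the time change: arrival times \<open>u\<close> and \<open>u + v\<close> on
  the clock \<open>E\<close> become \<open>D u\<close> and \<open>D (u + v)\<close> in real time,
  with independent gaps of laws \<open>K u\<close> and \<open>K v\<close>.\<close>

lemma emeasure_passage_pair:
  assumes "0 \<le> s" "s \<le> t" "0 \<le> u" "0 \<le> v"
  shows "emeasure (completion M) {\<omega> \<in> space M. u \<le> E s \<omega> \<and> u + v \<le> E t \<omega>}
    = emeasure (K u \<Otimes>\<^sub>M K v) {(x, y). x \<le> s \<and> x + y \<le> t}"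
proof -
  have [measurable]: "D u \<in> borel_measurable M" "D (u + v) \<in> borel_measurable M"
      "E s \<in> borel_measurable (completion M)" "E t \<in> borel_measurable (completion M)"
    using assms by auto
  have "emeasure (completion M) {\<omega> \<in> space M. u \<le> E s \<omega> \<and> u + v \<le> E t \<omega>}
      = emeasure (completion M) {\<omega> \<in> space M. D u \<omega> \<le> s \<and> D (u + v) \<omega> \<le> t}"
  proof (rule emeasure_eq_AE)
    have "AE \<omega> in M. \<omega> \<in> {\<omega> \<in> space M. u \<le> E s \<omega> \<and> u + v \<le> E t \<omega>}
        \<longleftrightarrow> \<omega> \<in> {\<omega> \<in> space M. D u \<omega> \<le> s \<and> D (u + v) \<omega> \<le> t}"
      using passage[OF \<open>0 \<le> s\<close> \<open>0 \<le> u\<close>] passage[of t "u + v"] assms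
      by (auto elim!: eventually_elim2 simp: not_less[symmetric])
    then show "AE \<omega> in completion M. \<omega> \<in> {\<omega> \<in> space M. u \<le> E s \<omega> \<and> u + v \<le> E t \<omega>}
        \<longleftrightarrow> \<omega> \<in> {\<omega> \<in> space M. D u \<omega> \<le> s \<and> D (u + v) \<omega> \<le> t}"
      by (rule AE_completion)
    have "Measurable.pred (completion M) (\<lambda>\<omega>. u \<le> E s \<omega> \<and> u + v \<le> E t \<omega>)" by measurable
    then show "{\<omega> \<in> space M. u \<le> E s \<omega> \<and> u + v \<le> E t \<omega>} \<in> sets (completion M)"
      by (simp add: pred_def)
    show "{\<omega> \<in> space M. D u \<omega> \<le> s \<and> D (u + v) \<omega> \<le> t} \<in> sets (completion M)"
      by (intro sets_completionI_sets) measurable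
  qed
  also have "\<dots> = emeasure M {\<omega> \<in> space M. D u \<omega> \<le> s \<and> D (u + v) \<omega> \<le> t}"
    by (subst emeasure_completion_sets) auto
  also have "\<dots> = emeasure (distr M (borel \<Otimes>\<^sub>M borel) (\<lambda>\<omega>. (D u \<omega>, D (u + v) \<omega> - D u \<omega>))) {(x, y). x \<le> s \<and> x + y \<le> t}"
  proof (subst emeasure_distr)
    show "emeasure M {\<omega> \<in> space M. D u \<omega> \<le> s \<and> D (u + v) \<omega> \<le> t}
      = emeasure M ((\<lambda>\<omega>. (D u \<omega>, D (u + v) \<omega> - D u \<omega>)) -` {(x, y). x \<le> s \<and> x + y \<le> t} \<inter> space M)"
      by (rule arg_cong[where f="emeasure M"]) auto
  next
    show "(\<lambda>\<omega>. (D u \<omega>, D (u + v) \<omega> - D u \<omega>)) \<in> M \<rightarrow>\<^sub>M borel \<Otimes>\<^sub>M borel" by measurable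
    show "{(x, y). x \<le> s \<and> x + y \<le> t} \<in> sets (borel \<Otimes>\<^sub>M borel)" by (rule joint_set_borel)
  qed
  finally show ?thesis using assms by (simp add: joint_law)
qed

section \<open>Mixtures of the laws of a subordinator over an independent time\<close>

lemma nonneg_law_bind:
  assumes "nonneg_law P"
  shows "nonneg_law (P \<bind> K)"
proof -
  interpret P: nonneg_law P by fact
  have [measurable]: "K \<in> P \<rightarrow>\<^sub>M subprob_algebra borel" by measurable
  show ?thesis
    unfolding nonneg_law_def nonneg_law_axioms_def
  proof (intro conjI)
    show "prob_space (P \<bind> K)"
      by (rule P.prob_space_bind[where S=borel]) (use nonneg_law.axioms(1)[OF nonneg_law_K] in auto)
    show "sets (P \<bind> K) = sets borel"
      by (rule sets_bind_measurable) auto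
    show "AE x in P \<bind> K. 0 \<le> x"
      by (subst AE_bind[where B=borel]) (auto simp: nonneg_law.nonneg[OF nonneg_law_K])
  qed
qed

lemma laplace_transform_bind:
  assumes "nonneg_law P" "0 < x"
  shows "laplace_transform (P \<bind> K) x = laplace_transform P (\<psi> x)"
proof -
  interpret P: nonneg_law P by fact
  have [measurable]: "K \<in> P \<rightarrow>\<^sub>M subprob_algebra borel" by measurable
  have "laplace_transform (P \<bind> K) x = (\<integral>\<^sup>+r. laplace_transform (K r) x \<partial>P)"
    unfolding laplace_transform_def by (rule nn_integral_bind) measurable
  also have "\<dots> = laplace_transform P (\<psi> x)"
    unfolding laplace_transform_def[of P]
  proof (rule nn_integral_cong_AE)
    show "AE r in P. laplace_transform (K r) x = ennreal (exp (- \<psi> x * r))"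
      using P.nonneg by eventually_elim (simp add: laplace_transform_K assms(2) mult.commute)
  qed
  finally show ?thesis .
qed

text \<open>Both sides have transform \<open>laplace_transform Q (\<psi> x) ^ n\<close>. In terms of
  processes, \<open>D\<close> run for a sum of independent times splits into independent
  pieces.\<close>

lemma convolution_power_bind:
  assumes "nonneg_law Q"
  shows "convolution_power (Q \<bind> K) n = convolution_power Q n \<bind> K"
  using assms
  by (intro laplace_transform_unique)
     (simp_all add: nonneg_law_convolution_power nonneg_law_bind laplace_transform_convolution_power
        laplace_transform_bind)

lemma measurable_joint_prob_E:
  assumes "nonneg_law P" "nonneg_law Q" "0 \<le> s" "0 \<le> t"
  shows "(\<lambda>\<omega>. joint_prob P Q (E s \<omega>) (E t \<omega>)) \<in> borel_measurable (completion M)"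
proof -
  interpret P: nonneg_law P by fact
  interpret Q: nonneg_law Q by fact
  have [measurable]: "E s \<in> borel_measurable (completion M)" "E t \<in> borel_measurable (completion M)"
    using assms by auto
  have "(\<lambda>\<omega>. \<integral>\<^sup>+u. \<integral>\<^sup>+v. (of_bool (u \<le> E s \<omega> \<and> u + v \<le> E t \<omega>) :: ennreal) \<partial>Q \<partial>P) \<in> borel_measurable (completion M)"
    by measurable
  then have "(\<lambda>\<omega>. ennreal (joint_prob P Q (E s \<omega>) (E t \<omega>))) \<in> borel_measurable (completion M)"
    by (simp add: ennreal_joint_prob assms indicator_def)
  then have "(\<lambda>\<omega>. enn2real (ennreal (joint_prob P Q (E s \<omega>) (E t \<omega>)))) \<in> borel_measurable (completion M)"
    by measurable
  then show ?thesis by (simp add: joint_prob_def)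
qed

lemma joint_prob_le_1:
  assumes "nonneg_law P" "nonneg_law Q"
  shows "joint_prob P Q a b \<le> 1" "0 \<le> joint_prob P Q a b"
proof -
  interpret P: nonneg_law P by fact
  interpret Q: nonneg_law Q by fact
  interpret PQ: pair_prob_space P Q ..
  show "joint_prob P Q a b \<le> 1" "0 \<le> joint_prob P Q a b"
    by (simp_all add: joint_prob_def)
qed

text \<open>Fubini fixes the pair \<open>(u, v)\<close> drawn from \<open>P\<close> and
  \<open>Q\<close> and leaves the probability that \<open>E\<close> has passed \<open>u\<close> and
  \<open>u + v\<close>. By \<open>emeasure_passage_pair\<close> this is an integral against
  \<open>K u\<close> and \<open>K v\<close>, and collecting the integrals yields the two
  mixtures.\<close>

lemma expectation_joint_prob:
  assumes P: "nonneg_law P" and Q: "nonneg_law Q" and st: "0 \<le> s" "s \<le> t"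
  shows "integrable (completion M) (\<lambda>\<omega>. joint_prob P Q (E s \<omega>) (E t \<omega>))"
    and "(\<integral>\<omega>. joint_prob P Q (E s \<omega>) (E t \<omega>) \<partial>completion M) = joint_prob (P \<bind> K) (Q \<bind> K) s t"
proof -
  interpret P: nonneg_law P by fact
  interpret Q: nonneg_law Q by fact
  interpret PQ: pair_prob_space P Q ..
  interpret C: prob_space "completion M" by (rule prob_space_completion)
  interpret CPQ: pair_sigma_finite "completion M" "P \<Otimes>\<^sub>M Q" ..
  have [measurable]: "E s \<in> borel_measurable (completion M)" "E t \<in> borel_measurable (completion M)"
    using st by auto
  have [measurable]: "K \<in> P \<rightarrow>\<^sub>M subprob_algebra borel" "K \<in> Q \<rightarrow>\<^sub>M subprob_algebra borel" by measurable
  let ?S = "{(x, y). x \<le> s \<and> x + y \<le> t}"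
  let ?g = "\<lambda>x y. of_bool (x \<le> s \<and> x + y \<le> t) :: ennreal"
  let ?h = "\<lambda>\<omega> z. of_bool (fst z \<le> E s \<omega> \<and> fst z + snd z \<le> E t \<omega>) :: ennreal"
  show int: "integrable (completion M) (\<lambda>\<omega>. joint_prob P Q (E s \<omega>) (E t \<omega>))"
    by (rule C.integrable_const_bound[where B=1])
       (use st in \<open>auto intro: measurable_joint_prob_E P Q joint_prob_le_1(1) simp: joint_prob_le_1(2)[OF P Q]\<close>)
  have AE_nonneg: "AE z in P \<Otimes>\<^sub>M Q. 0 \<le> fst z \<and> 0 \<le> snd z"
  proof (rule PQ.AE_pair_measure)
    show "AE u in P. AE v in Q. 0 \<le> fst (u, v) \<and> 0 \<le> snd (u, v)"
      using P.nonneg by eventually_elim (use Q.nonneg in simp)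
  qed measurable
  have "ennreal (\<integral>\<omega>. joint_prob P Q (E s \<omega>) (E t \<omega>) \<partial>completion M)
      = (\<integral>\<^sup>+\<omega>. ennreal (joint_prob P Q (E s \<omega>) (E t \<omega>)) \<partial>completion M)"
    by (rule nn_integral_eq_integral[symmetric]) (use int joint_prob_le_1(2)[OF P Q] in auto)
  also have "\<dots> = (\<integral>\<^sup>+\<omega>. \<integral>\<^sup>+z. ?h \<omega> z \<partial>(P \<Otimes>\<^sub>M Q) \<partial>completion M)"
    by (intro nn_integral_cong, subst Q.nn_integral_fst[symmetric])
       (auto simp: ennreal_joint_prob[OF P Q] indicator_def)
  also have "\<dots> = (\<integral>\<^sup>+z. \<integral>\<^sup>+\<omega>. ?h \<omega> z \<partial>completion M \<partial>(P \<Otimes>\<^sub>M Q))"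
    by (rule CPQ.Fubini'[symmetric]) measurable
  also have "\<dots> = (\<integral>\<^sup>+z. \<integral>\<^sup>+x. \<integral>\<^sup>+y. ?g x y \<partial>K (snd z) \<partial>K (fst z) \<partial>(P \<Otimes>\<^sub>M Q))"
  proof (rule nn_integral_cong_AE)
    show "AE z in P \<Otimes>\<^sub>M Q. (\<integral>\<^sup>+\<omega>. ?h \<omega> z \<partial>completion M) = (\<integral>\<^sup>+x. \<integral>\<^sup>+y. ?g x y \<partial>K (snd z) \<partial>K (fst z))"
      using AE_nonneg
    proof eventually_elim
      case (elim z)
      have "(\<integral>\<^sup>+\<omega>. ?h \<omega> z \<partial>completion M)
          = (\<integral>\<^sup>+\<omega>. indicator {\<omega> \<in> space M. fst z \<le> E s \<omega> \<and> fst z + snd z \<le> E t \<omega>} \<omega> \<partial>completion M)"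
        by (rule nn_integral_cong) (simp add: indicator_def)
      also have "\<dots> = emeasure (completion M) {\<omega> \<in> space M. fst z \<le> E s \<omega> \<and> fst z + snd z \<le> E t \<omega>}"
      proof (rule nn_integral_indicator)
        have "Measurable.pred (completion M) (\<lambda>\<omega>. fst z \<le> E s \<omega> \<and> fst z + snd z \<le> E t \<omega>)" by measurable
        then show "{\<omega> \<in> space M. fst z \<le> E s \<omega> \<and> fst z + snd z \<le> E t \<omega>} \<in> sets (completion M)"
          by (simp add: pred_def)
      qed
      also have "\<dots> = emeasure (K (fst z) \<Otimes>\<^sub>M K (snd z)) ?S"
        by (rule emeasure_passage_pair) (use st elim in auto)
      also have "\<dots> = (\<integral>\<^sup>+x. \<integral>\<^sup>+y. indicator ?S (x, y) \<partial>K (snd z) \<partial>K (fst z))"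
        by (rule emeasure_pair_nonneg_law[OF nonneg_law_K nonneg_law_K joint_pred_measurable])
      finally show ?case by (simp add: indicator_def)
    qed
  qed
  also have "\<dots> = (\<integral>\<^sup>+u. \<integral>\<^sup>+v. \<integral>\<^sup>+x. \<integral>\<^sup>+y. ?g x y \<partial>K v \<partial>K u \<partial>Q \<partial>P)"
  proof (subst Q.nn_integral_fst[symmetric])
    have "(\<lambda>z. \<integral>\<^sup>+x. \<integral>\<^sup>+y. ?g x y \<partial>K (snd z) \<partial>K (fst z)) \<in> borel_measurable (borel \<Otimes>\<^sub>M borel)"
    proof (rule nn_integral_measurable_subprob_algebra2[where N=borel])
      have "(\<lambda>w. \<integral>\<^sup>+y. ?g (snd w) y \<partial>K (snd (fst w))) \<in> borel_measurable ((borel \<Otimes>\<^sub>M borel) \<Otimes>\<^sub>M borel)"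
        by (rule nn_integral_measurable_subprob_algebra2[where N=borel]) measurable
      then show "(\<lambda>(z, x). \<integral>\<^sup>+y. ?g x y \<partial>K (snd z)) \<in> borel_measurable ((borel \<Otimes>\<^sub>M borel) \<Otimes>\<^sub>M borel)"
        by (simp add: case_prod_beta')
    qed measurable
    then show "(\<lambda>z. \<integral>\<^sup>+x. \<integral>\<^sup>+y. ?g x y \<partial>K (snd z) \<partial>K (fst z)) \<in> borel_measurable (P \<Otimes>\<^sub>M Q)"
      by (simp add: measurable_cong_sets[OF sets_pair_measure_cong[OF P.sets_P Q.sets_P] refl])
  qed simp
  \<comment> \<open>Exchanging \<open>v\<close> and \<open>x\<close> puts \<open>Q\<close> next to
    its kernel \<open>K v\<close> and \<open>P\<close> next to \<open>K u\<close>, the shape needed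
    for the two binds.\<close>
  also have "\<dots> = (\<integral>\<^sup>+u. \<integral>\<^sup>+x. \<integral>\<^sup>+v. \<integral>\<^sup>+y. ?g x y \<partial>K v \<partial>Q \<partial>K u \<partial>P)"
  proof (rule nn_integral_cong)
    fix u
    interpret Ku: nonneg_law "K u" by (rule nonneg_law_K)
    interpret KQ: pair_prob_space "K u" Q ..
    show "(\<integral>\<^sup>+v. \<integral>\<^sup>+x. \<integral>\<^sup>+y. ?g x y \<partial>K v \<partial>K u \<partial>Q) = (\<integral>\<^sup>+x. \<integral>\<^sup>+v. \<integral>\<^sup>+y. ?g x y \<partial>K v \<partial>Q \<partial>K u)"
    proof (rule KQ.Fubini')
      have "(\<lambda>w. \<integral>\<^sup>+y. ?g (fst w) y \<partial>K (snd w)) \<in> borel_measurable (borel \<Otimes>\<^sub>M borel)"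
        by (rule nn_integral_measurable_subprob_algebra2[where N=borel]) measurable
      then show "(\<lambda>(x, v). \<integral>\<^sup>+y. ?g x y \<partial>K v) \<in> borel_measurable (K u \<Otimes>\<^sub>M Q)"
        by (simp add: case_prod_beta' measurable_cong_sets[OF sets_pair_measure_cong[OF Ku.sets_P Q.sets_P] refl])
    qed
  qed
  also have "\<dots> = (\<integral>\<^sup>+u. \<integral>\<^sup>+x. \<integral>\<^sup>+y. ?g x y \<partial>(Q \<bind> K) \<partial>K u \<partial>P)"
    by (intro nn_integral_cong nn_integral_bind[where B=borel, symmetric]) measurable
  also have "\<dots> = (\<integral>\<^sup>+x. \<integral>\<^sup>+y. ?g x y \<partial>(Q \<bind> K) \<partial>(P \<bind> K))"
  proof (rule nn_integral_bind[where B=borel, symmetric])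
    interpret QK: nonneg_law "Q \<bind> K" by (rule nonneg_law_bind[OF Q])
    show "(\<lambda>x. \<integral>\<^sup>+y. ?g x y \<partial>(Q \<bind> K)) \<in> borel_measurable borel" by measurable
  qed measurable
  also have "\<dots> = ennreal (joint_prob (P \<bind> K) (Q \<bind> K) s t)"
    by (simp add: ennreal_joint_prob nonneg_law_bind P Q indicator_def)
  finally show "(\<integral>\<omega>. joint_prob P Q (E s \<omega>) (E t \<omega>) \<partial>completion M) = joint_prob (P \<bind> K) (Q \<bind> K) s t"
    by (subst (asm) ennreal_inj) (auto intro!: Bochner_Integration.integral_nonneg joint_prob_le_1(2) P Q nonneg_law_bind)
qed

text \<open>By linearity from the four \<open>joint_prob\<close> terms, as powers commute with
  \<open>\<bind> K\<close>. Hence the renewal form is stable under time change, with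
  \<open>Q\<close> replaced by \<open>Q \<bind> K\<close>.\<close>

lemma expectation_renewal_prob:
  assumes "nonneg_law Q" "0 \<le> s" "s \<le> t"
  shows "(\<integral>\<omega>. renewal_prob Q m n (E s \<omega>) (E t \<omega>) \<partial>completion M) = renewal_prob (Q \<bind> K) m n s t"
  unfolding renewal_prob_def convolution_power_bind[OF assms(1)]
  using assms by (simp add: expectation_joint_prob nonneg_law_convolution_power del: convolution_power.simps)

end

subsection \<open>The Poisson process\<close>

definition exponential_law :: "real \<Rightarrow> real measure" where
  "exponential_law l = density lborel (\<lambda>x. ennreal (exponential_density l x))"

lemma sets_exponential_law [simp, measurable_cong]: "sets (exponential_law l) = sets borel"
  by (simp add: exponential_law_def)

lemma nonneg_law_exponential:
  assumes "0 < l"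
  shows "nonneg_law (exponential_law l)"
  unfolding nonneg_law_def nonneg_law_axioms_def
proof (intro conjI)
  show "prob_space (exponential_law l)"
    unfolding exponential_law_def by (rule prob_space_exponential_density[OF assms])
  show "AE x in exponential_law l. 0 \<le> x"
    unfolding exponential_law_def by (subst AE_density) (auto simp: erlang_density_def)
qed simp

lemma integral_exponential_law:
  fixes g :: "real \<Rightarrow> real"
  assumes "0 < l" and [measurable]: "g \<in> borel_measurable borel"
  shows "(\<integral>x. g x \<partial>exponential_law l) = (\<integral>x. exponential_density l x * g x \<partial>lborel)"
  unfolding exponential_law_def using assms
  by (subst integral_density) (auto intro!: AE_I2)

lemma measure_exponential_law_greaterThan:
  assumes "0 < l" "0 \<le> c"
  shows "measure (exponential_law l) {c<..} = exp (- l * c)"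
proof -
  interpret nonneg_law "exponential_law l" by (rule nonneg_law_exponential[OF assms(1)])
  have "emeasure (exponential_law l) {..c} = ennreal (1 - exp (- l * c))"
    unfolding exponential_law_def using emeasure_erlang_density[OF assms(1), of 0 c] assms
    by (simp add: erlang_CDF_def)
  then have "measure (exponential_law l) {..c} = 1 - exp (- l * c)"
    using assms by (simp add: measure_def)
  then show ?thesis by (simp add: measure_greaterThan)
qed

text \<open>The Poisson weights as functions of the mean. At mean 0 the convention
  \<open>0 ^ 0 = 1\<close> makes them the point mass at 0, the law of the process at time 0.\<close>

definition poisson_density :: "real \<Rightarrow> nat \<Rightarrow> real" where
  "poisson_density x k = exp (- x) * x ^ k / fact k"

text \<open>The two exponential factors multiply to the constant \<open>exp (- l * c)\<close>, so a
  polynomial is left to integrate. The lower limit \<open>p\<close> is 0 when conditioning on the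
  first waiting time and \<open>a - u\<close> for the waiting time that straddles
  \<open>a\<close>.\<close>

lemma integral_exponential_poisson:
  assumes l: "0 < l" and pc: "0 \<le> p" "p \<le> c"
  shows "(\<integral>v. indicator {p<..c} v * poisson_density (l * (c - v)) k \<partial>exponential_law l)
    = exp (- l * c) * (l * (c - p)) ^ Suc k / fact (Suc k)"
proof -
  let ?F = "\<lambda>v. - (exp (- l * c) * (l * (c - v)) ^ Suc k / fact (Suc k))"
  let ?f = "\<lambda>v. exp (- l * c) * l * (l * (c - v)) ^ k / fact k"
  have [measurable]: "(\<lambda>v. indicator {p<..c} v * poisson_density (l * (c - v)) k) \<in> borel_measurable borel"
    unfolding poisson_density_def by measurable
  have "(\<integral>v. indicator {p<..c} v * poisson_density (l * (c - v)) k \<partial>exponential_law l)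
      = (\<integral>v. exponential_density l v * (indicator {p<..c} v * poisson_density (l * (c - v)) k) \<partial>lborel)"
    by (rule integral_exponential_law[OF l]) measurable
  also have "\<dots> = (\<integral>v. indicator {p..c} v *\<^sub>R ?f v \<partial>lborel)"
  proof (rule integral_cong_AE)
    show "AE v in lborel. exponential_density l v * (indicator {p<..c} v * poisson_density (l * (c - v)) k)
        = indicator {p..c} v *\<^sub>R ?f v"
      using AE_lborel_singleton[of p]
      by eventually_elim
        (use pc in \<open>auto simp: exponential_density_def poisson_density_def indicator_def algebra_simps
           simp flip: exp_add\<close>)
  qed measurable
  also have "\<dots> = ?F c - ?F p"
  proof (rule integral_FTC_atLeastAtMost[OF pc(2)])
    fix v
    have "((\<lambda>v. l * (c - v)) has_real_derivative - l) (at v)"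
      by (auto intro!: derivative_eq_intros)
    from DERIV_power_Suc[OF this, of k]
    have "((\<lambda>v. (l * (c - v)) ^ Suc k) has_real_derivative real (Suc k) * (l * (c - v)) ^ k * (- l)) (at v)"
      by (simp add: algebra_simps)
    then have "(?F has_real_derivative
        - (exp (- l * c) * (real (Suc k) * (l * (c - v)) ^ k * (- l)) / fact (Suc k))) (at v)"
      by (intro DERIV_minus DERIV_cdivide DERIV_cmult)
    moreover have "- (exp (- l * c) * (real (Suc k) * (l * (c - v)) ^ k * (- l)) / fact (Suc k)) = ?f v"
      by (simp add: field_simps del: of_nat_Suc)
    ultimately have "(?F has_real_derivative ?f v) (at v)" by (simp only:)
    then show "(?F has_vector_derivative ?f v) (at v within {p..c})"
      unfolding has_real_derivative_iff_has_vector_derivative by (rule has_vector_derivative_at_within)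
  qed (auto intro!: continuous_intros)
  finally show ?thesis by simp
qed

lemma integral_convolution:
  assumes "nonneg_law P" "nonneg_law Q" and [measurable]: "g \<in> borel_measurable borel" and "\<And>x. \<bar>g x\<bar> \<le> (B :: real)"
  shows "(\<integral>x. g x \<partial>convolution P Q) = (\<integral>u. \<integral>v. g (u + v) \<partial>Q \<partial>P)"
proof -
  interpret P: nonneg_law P by fact
  interpret Q: nonneg_law Q by fact
  interpret PQ: pair_prob_space P Q ..
  have "(\<integral>x. g x \<partial>convolution P Q) = (\<integral>z. g (fst z + snd z) \<partial>(P \<Otimes>\<^sub>M Q))"
    unfolding convolution_def by (subst integral_distr) (auto simp: case_prod_beta')
  also have "\<dots> = (\<integral>u. \<integral>v. g (u + v) \<partial>Q \<partial>P)"
    by (subst PQ.integral_fst'[symmetric]) (auto intro!: PQ.integrable_const_bound[where B=B] simp: assms)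
  finally show ?thesis .
qed

lemma AE_exponential_law_pos:
  assumes "0 < l"
  shows "AE x in exponential_law l. 0 < x"
  unfolding exponential_law_def
proof (subst AE_density)
  show "AE x in lborel. 0 < ennreal (exponential_density l x) \<longrightarrow> 0 < x"
    using AE_lborel_singleton[of 0]
  proof eventually_elim
    case (elim x)
    then show ?case by (cases "x < 0") (auto simp: exponential_density_def)
  qed
qed simp

text \<open>The left side is the probability that exactly \<open>k\<close> arrivals occur up to time
  \<open>c\<close>. Conditioning on the first waiting time \<open>v\<close> reduces
  \<open>k + 1\<close> arrivals before \<open>c\<close> to \<open>k\<close> arrivals before
  \<open>c - v\<close>, hence the induction with arbitrary \<open>c\<close>.\<close>

lemma exponential_renewal_count:
  assumes l: "0 < l" and "0 \<le> c"
  shows "(\<integral>x. indicator {..c} x * measure (exponential_law l) {c - x<..} \<partial>convolution_power (exponential_law l) k)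
    = poisson_density (l * c) k"
proof -
  let ?X = "exponential_law l"
  interpret X: nonneg_law ?X by (rule nonneg_law_exponential[OF l])
  \<comment> \<open>On the support of the indicator \<open>c - x\<close> is nonnegative, so the
    survival probability is an exponential there; this form is visibly bounded and
    measurable.\<close>
  let ?g = "\<lambda>c x. indicator {..c} x * exp (- l * (c - x))"
  have g_bound: "\<bar>?g c x\<bar> \<le> 1" for c x
    using l by (simp add: indicator_def)
  have "(\<integral>x. ?g c x \<partial>convolution_power ?X k) = poisson_density (l * c) k"
    using assms(2)
  proof (induction k arbitrary: c)
    case 0
    then show ?case
      by (simp add: integral_return poisson_density_def)
  next
    case (Suc k)
    let ?B = "convolution_power ?X k"
    interpret B: nonneg_law ?B by (rule nonneg_law_convolution_power[OF X.nonneg_law_axioms])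
    have "(\<integral>x. ?g c x \<partial>convolution_power ?X (Suc k)) = (\<integral>v. \<integral>x. ?g c (v + x) \<partial>?B \<partial>?X)"
      unfolding convolution_power.simps
      by (rule integral_convolution[OF X.nonneg_law_axioms B.nonneg_law_axioms _ g_bound]) measurable
    also have "\<dots> = (\<integral>v. indicator {0<..c} v * poisson_density (l * (c - v)) k \<partial>?X)"
    proof (rule integral_cong_AE)
      show "AE v in ?X. (\<integral>x. ?g c (v + x) \<partial>?B) = indicator {0<..c} v * poisson_density (l * (c - v)) k"
        using AE_exponential_law_pos[OF l]
      proof eventually_elim
        case (elim v)
        show ?case
        proof (cases "v \<le> c")
          case True
          have "(\<integral>x. ?g c (v + x) \<partial>?B) = (\<integral>x. ?g (c - v) x \<partial>?B)"
            by (intro Bochner_Integration.integral_cong refl) (simp add: indicator_def algebra_simps)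
          then show ?thesis using Suc.IH[of "c - v"] True elim by simp
        next
          case False
          have "(\<integral>x. ?g c (v + x) \<partial>?B) = 0"
          proof (rule integral_eq_zero_AE)
            show "AE x in ?B. ?g c (v + x) = 0"
              using B.nonneg by eventually_elim (use False in \<open>simp add: indicator_def\<close>)
          qed
          then show ?thesis using False by simp
        qed
      qed
      show "(\<lambda>v. \<integral>x. ?g c (v + x) \<partial>?B) \<in> borel_measurable ?X" by measurable
      show "(\<lambda>v. indicator {0<..c} v * poisson_density (l * (c - v)) k) \<in> borel_measurable ?X"
        unfolding poisson_density_def by measurable
    qed
    also have "\<dots> = poisson_density (l * c) (Suc k)"
      using integral_exponential_poisson[OF l order_refl Suc.prems, of k] by (simp add: poisson_density_def)
    finally show ?case .
  qed
  moreover have "indicator {..c} x * measure ?X {c - x<..} = ?g c x" for x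
    by (cases "x \<le> c") (simp_all add: measure_exponential_law_greaterThan[OF l])
  ultimately show ?thesis by (simp only:)
qed

text \<open>Lack of memory: for an arrival at \<open>u\<close>, the factor after it depends on
  \<open>u\<close> only through \<open>exp (- l * (a - u))\<close>, the survival probability up to
  \<open>a\<close>. What remains is a constant in \<open>b - a\<close>, and the integral over
  \<open>u\<close> counts arrivals up to \<open>a\<close>.\<close>

lemma renewal_prob_exponential:
  assumes l: "0 < l" and ab: "0 \<le> a" "a \<le> b" and "m \<le> n"
  shows "renewal_prob (exponential_law l) m n a b = poisson_density (l * a) m * poisson_density (l * (b - a)) (n - m)"
proof -
  let ?X = "exponential_law l"
  interpret X: nonneg_law ?X by (rule nonneg_law_exponential[OF l])
  let ?A = "convolution_power ?X m"
  interpret A: nonneg_law ?A by (rule nonneg_law_convolution_power[OF X.nonneg_law_axioms])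
  have scale: "(\<integral>u. indicator {..a} u * (measure ?X {a - u<..} * d) \<partial>?A) = poisson_density (l * a) m * d" for d
    unfolding exponential_renewal_count[OF l ab(1), symmetric] by (simp flip: mult.assoc)
  show ?thesis
  proof (cases "n = m")
    case True
    have "renewal_prob ?X m m a b = (\<integral>u. indicator {..a} u * (measure ?X {a - u<..} * exp (- l * (b - a))) \<partial>?A)"
      unfolding renewal_prob_no_jump[OF X.nonneg_law_axioms ab(2)]
    proof (intro Bochner_Integration.integral_cong refl)
      fix u
      show "indicator {..a} u * measure ?X {b - u<..} = indicator {..a} u * (measure ?X {a - u<..} * exp (- l * (b - a)))"
        using ab by (cases "u \<le> a")
          (simp_all add: measure_exponential_law_greaterThan[OF l] algebra_simps flip: exp_add)
    qed
    then show ?thesis unfolding scale using True by (simp add: poisson_density_def)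
  next
    case False
    define k where "k = n - m - 1"
    have n: "n = m + 1 + k" using False \<open>m \<le> n\<close> by (simp add: k_def)
    let ?R = "(l * (b - a)) ^ Suc k / fact (Suc k)"
    have "renewal_prob ?X m n a b = (\<integral>u. indicator {..a} u * (measure ?X {a - u<..} * (exp (- l * (b - a)) * ?R)) \<partial>?A)"
      unfolding n renewal_prob_jump[OF X.nonneg_law_axioms ab(2)]
    proof (intro Bochner_Integration.integral_cong refl)
      fix u
      show "indicator {..a} u * (\<integral>v. indicator {a - u<..b - u} v *
          (\<integral>x. indicator {..b - (u + v)} x * measure ?X {b - u - v - x<..} \<partial>convolution_power ?X k) \<partial>?X)
        = indicator {..a} u * (measure ?X {a - u<..} * (exp (- l * (b - a)) * ?R))"
      proof (cases "u \<le> a")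
        case True
        have "(\<integral>v. indicator {a - u<..b - u} v *
          (\<integral>x. indicator {..b - (u + v)} x * measure ?X {b - u - v - x<..} \<partial>convolution_power ?X k) \<partial>?X)
          = (\<integral>v. indicator {a - u<..b - u} v * poisson_density (l * ((b - u) - v)) k \<partial>?X)"
        proof (intro Bochner_Integration.integral_cong refl)
          fix v
          show "indicator {a - u<..b - u} v *
              (\<integral>x. indicator {..b - (u + v)} x * measure ?X {b - u - v - x<..} \<partial>convolution_power ?X k)
            = indicator {a - u<..b - u} v * poisson_density (l * ((b - u) - v)) k"
            using exponential_renewal_count[OF l, of "b - u - v" k]
            by (cases "v \<le> b - u") (simp_all add: diff_diff_eq)
        qed
        also have "\<dots> = exp (- l * (b - u)) * (l * ((b - u) - (a - u))) ^ Suc k / fact (Suc k)"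
          by (rule integral_exponential_poisson[OF l]) (use True ab in auto)
        also have "\<dots> = measure ?X {a - u<..} * (exp (- l * (b - a)) * ?R)"
        proof -
          have "exp (- l * (b - u)) = exp (- l * (a - u)) * exp (- l * (b - a))"
            by (simp add: algebra_simps flip: exp_add)
          moreover have "b - u - (a - u) = b - a" by simp
          ultimately show ?thesis
            using True by (simp only: measure_exponential_law_greaterThan[OF l] diff_ge_0_iff_ge times_divide_eq_right mult.assoc)
        qed
        finally show ?thesis by simp
      qed simp
    qed
    then show ?thesis
      unfolding scale by (simp add: n poisson_density_def)
  qed
qed

lemma poisson_process_event:
  assumes "poisson_process M l N" "0 \<le> a" "0 \<le> b"
  shows "{\<omega> \<in> space M. N a \<omega> = m \<and> N b \<omega> = n} \<in> sets M"
proof -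
  have [measurable]: "(\<lambda>\<omega>. real (N a \<omega>)) \<in> borel_measurable M" "(\<lambda>\<omega>. real (N b \<omega>)) \<in> borel_measurable M"
    using assms by (auto simp: poisson_process_def levy_process_def)
  have "{\<omega> \<in> space M. N a \<omega> = m \<and> N b \<omega> = n} = {\<omega> \<in> space M. real (N a \<omega>) = real m \<and> real (N b \<omega>) = real n}"
    by auto
  also have "\<dots> \<in> sets M" by measurable
  finally show ?thesis .
qed

text \<open>Both sides are a product of two Poisson weights: on the left by independence and
  stationarity of the increments over \<open>0\<close>, \<open>a\<close>, \<open>b\<close>, on the
  right by \<open>renewal_prob_exponential\<close>.\<close>

lemma poisson_process_two_point:
  assumes "prob_space M" and N: "poisson_process M l N" and l: "0 < l"
    and ab: "0 \<le> a" "a \<le> b" and "m \<le> n"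
  shows "measure M {\<omega> \<in> space M. N a \<omega> = m \<and> N b \<omega> = n} = renewal_prob (exponential_law l) m n a b"
proof -
  interpret prob_space M by fact
  have levy: "levy_process M (\<lambda>t \<omega>. real (N t \<omega>))"
    and law: "0 < t \<Longrightarrow> distr M (count_space UNIV) (N t) = measure_pmf (poisson_pmf (l * t))" for t
    using N by (auto simp: poisson_process_def)
  have meas[measurable]: "0 \<le> t \<Longrightarrow> (\<lambda>\<omega>. real (N t \<omega>)) \<in> borel_measurable M" for t
    using levy by (auto simp: levy_process_def)
  have [measurable]: "(\<lambda>\<omega>. real (N 0 \<omega>)) \<in> borel_measurable M" by (rule meas) simp
  have N_0: "AE \<omega> in M. N 0 \<omega> = 0"
    using levy by (auto simp: levy_process_def)
  have pmf: "prob {\<omega> \<in> space M. real (N t \<omega>) = real k} = poisson_density (l * t) k" if "0 \<le> t" for t k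
  \<comment> \<open>\<open>poisson_process\<close> prescribes the law at positive times; at time 0
    the value is 0 almost surely.\<close>
  proof (cases "t = 0")
    case True
    have S: "{\<omega> \<in> space M. real (N 0 \<omega>) = real k} \<in> sets M" by measurable
    have "prob {\<omega> \<in> space M. real (N 0 \<omega>) = real k} = (if k = 0 then 1 else 0)"
    proof (cases "k = 0")
      case True
      have "prob {\<omega> \<in> space M. real (N 0 \<omega>) = real k} = 1"
        using N_0 True by (intro prob_Collect_eq_1[OF S, THEN iffD2]) auto
      then show ?thesis using True by simp
    next
      case False
      have "prob {\<omega> \<in> space M. real (N 0 \<omega>) = real k} = 0"
        using N_0 False by (intro prob_Collect_eq_0[OF S, THEN iffD2]) (auto elim!: eventually_mono)
      then show ?thesis using False by simp
    qed
    then show ?thesis using True by (simp add: poisson_density_def)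
  next
    case False
    have [measurable]: "(\<lambda>\<omega>. real (N t \<omega>)) \<in> borel_measurable M" by (rule meas[OF that])
    \<comment> \<open>Only the real-valued version is measurable by definition; the floor leads back
      to the natural numbers.\<close>
    have "(\<lambda>\<omega>. nat \<lfloor>real (N t \<omega>)\<rfloor>) \<in> M \<rightarrow>\<^sub>M count_space UNIV" by measurable
    then have nm: "N t \<in> M \<rightarrow>\<^sub>M count_space UNIV" by simp
    have "prob {\<omega> \<in> space M. real (N t \<omega>) = real k} = measure (distr M (count_space UNIV) (N t)) {k}"
      by (subst measure_distr[OF nm]) (auto intro!: arg_cong[where f=prob])
    also have "\<dots> = pmf (poisson_pmf (l * t)) k"
      using law[of t] that False by (simp add: measure_pmf_single)
    also have "\<dots> = poisson_density (l * t) k"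
      using l that False by (subst pmf_poisson) (auto simp: poisson_density_def)
    finally show ?thesis .
  qed
  define \<tau> :: "nat \<Rightarrow> real" where "\<tau> i = (if i = 0 then 0 else if i = 1 then a else b)" for i
  let ?X = "\<lambda>i \<omega>. real (N (\<tau> (Suc i)) \<omega>) - real (N (\<tau> i) \<omega>)"
  have [measurable]: "(\<lambda>\<omega>. real (N 0 \<omega>)) \<in> borel_measurable M" "(\<lambda>\<omega>. real (N a \<omega>)) \<in> borel_measurable M"
      "(\<lambda>\<omega>. real (N b \<omega>)) \<in> borel_measurable M" "(\<lambda>\<omega>. real (N (b - a) \<omega>)) \<in> borel_measurable M"
    using ab by (auto intro: meas)
  have X_meas[measurable]: "?X 0 \<in> borel_measurable M" "?X 1 \<in> borel_measurable M"
    by (simp_all add: \<tau>_def)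
  have "independent_increments M (\<lambda>t \<omega>. real (N t \<omega>))"
    using levy by (simp add: levy_process_def)
  then have "indep_vars (\<lambda>_. borel) ?X {..<2}"
    unfolding independent_increments_def
    by (elim allE[of _ \<tau>] allE[of _ 2] impE) (use ab in \<open>auto simp: \<tau>_def\<close>)
  note indep = indep_vars_pair[OF this, of "{real m}" "{real (n - m)}"]
  have "measure M {\<omega> \<in> space M. N a \<omega> = m \<and> N b \<omega> = n}
      = prob (?X 0 -` {real m} \<inter> ?X 1 -` {real (n - m)} \<inter> space M)"
  proof (rule finite_measure_eq_AE)
    show "AE \<omega> in M. \<omega> \<in> {\<omega> \<in> space M. N a \<omega> = m \<and> N b \<omega> = n}
        \<longleftrightarrow> \<omega> \<in> ?X 0 -` {real m} \<inter> ?X 1 -` {real (n - m)} \<inter> space M"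
      using N_0 by eventually_elim (use \<open>m \<le> n\<close> in \<open>auto simp: \<tau>_def of_nat_diff\<close>)
    show "{\<omega> \<in> space M. N a \<omega> = m \<and> N b \<omega> = n} \<in> sets M"
      by (rule poisson_process_event[OF N]) (use ab in auto)
    have "?X 0 -` {real m} \<inter> ?X 1 -` {real (n - m)} \<inter> space M
        = {\<omega> \<in> space M. ?X 0 \<omega> = real m \<and> ?X 1 \<omega> = real (n - m)}"
      by auto
    also have "\<dots> \<in> sets M" by measurable
    finally show "?X 0 -` {real m} \<inter> ?X 1 -` {real (n - m)} \<inter> space M \<in> sets M" .
  qed
  also have "\<dots> = prob (?X 0 -` {real m} \<inter> space M) * prob (?X 1 -` {real (n - m)} \<inter> space M)"
    using indep by (simp add: emeasure_eq_measure flip: ennreal_mult)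
  also have "prob (?X 0 -` {real m} \<inter> space M) = prob {\<omega> \<in> space M. real (N a \<omega>) = real m}"
  proof (rule finite_measure_eq_AE)
    show "AE \<omega> in M. \<omega> \<in> ?X 0 -` {real m} \<inter> space M \<longleftrightarrow> \<omega> \<in> {\<omega> \<in> space M. real (N a \<omega>) = real m}"
      using N_0 by eventually_elim (auto simp: \<tau>_def)
    show "?X 0 -` {real m} \<inter> space M \<in> sets M"
      using X_meas(1) by (rule measurable_sets) simp
  qed measurable
  also have "prob (?X 1 -` {real (n - m)} \<inter> space M) = prob {\<omega> \<in> space M. real (N (b - a) \<omega>) = real (n - m)}"
  proof -
    have "distr M borel (?X 1) = distr M borel (\<lambda>\<omega>. real (N (b - a) \<omega>))"
    proof -
      have "stationary_increments M (\<lambda>t \<omega>. real (N t \<omega>))"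
        using levy by (simp add: levy_process_def)
      from this[unfolded stationary_increments_def, rule_format, of a "b - a"] show ?thesis
        using ab by (simp add: \<tau>_def)
    qed
    moreover have "measure (distr M borel (?X 1)) {real (n - m)} = prob (?X 1 -` {real (n - m)} \<inter> space M)"
      by (rule measure_distr[OF X_meas(2)]) simp
    moreover have "measure (distr M borel (\<lambda>\<omega>. real (N (b - a) \<omega>))) {real (n - m)}
        = prob {\<omega> \<in> space M. real (N (b - a) \<omega>) = real (n - m)}"
      by (subst measure_distr) (measurable, auto intro!: arg_cong[where f=prob])
    ultimately show ?thesis by (simp only:)
  qed
  finally show ?thesis
    using pmf[of a m] pmf[of "b - a" "n - m"] ab by (simp add: renewal_prob_exponential[OF l ab \<open>m \<le> n\<close>])
qed

lemma poisson_process_renewal: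
  assumes "prob_space M" "poisson_process M l N" "0 < l" "0 \<le> a" "a \<le> b" "m \<le> n"
  shows "measure (completion M) {\<omega> \<in> space M. N a \<omega> = m \<and> N b \<omega> = n} = renewal_prob (exponential_law l) m n a b"
  using poisson_process_two_point[OF assms] poisson_process_event[OF assms(2), of a b m n] assms by simp

subsection \<open>Independent random time changes\<close>

text \<open>For integer values right-continuity is local constancy to the right. This gives equality
  of values along an approximation, hence eventual equality of events.\<close>

definition right_continuous_path :: "(real \<Rightarrow> nat) \<Rightarrow> bool" where
  "right_continuous_path x \<longleftrightarrow> (\<forall>t\<ge>0. \<forall>\<^sub>F r in at_right t. x r = x t)"

lemma right_continuous_pathI:
  assumes "\<And>t. 0 \<le> t \<Longrightarrow> ((\<lambda>r. real (x r)) \<longlongrightarrow> real (x t)) (at_right t)"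
  shows "right_continuous_path x"
  unfolding right_continuous_path_def
proof (intro allI impI)
  fix t :: real assume "0 \<le> t"
  have "\<forall>\<^sub>F r in at_right t. dist (real (x r)) (real (x t)) < 1"
    using assms[OF \<open>0 \<le> t\<close>] by (rule tendstoD) simp
  then show "\<forall>\<^sub>F r in at_right t. x r = x t"
    by eventually_elim (simp add: dist_real_def)
qed

text \<open>Just after \<open>t\<close> the monotone \<open>e\<close> either rests at
  \<open>e t\<close> or exceeds it slightly, and \<open>x\<close> takes the value
  \<open>x (e t)\<close> in both cases.\<close>

lemma right_continuous_path_compose:
  assumes x: "right_continuous_path x"
    and e: "\<And>t. 0 \<le> e t" "\<And>s t. s \<le> t \<Longrightarrow> e s \<le> e t" "\<And>t. (e \<longlongrightarrow> e t) (at_right t)"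
  shows "right_continuous_path (\<lambda>t. x (e t))"
  unfolding right_continuous_path_def
proof (intro allI impI)
  fix t :: real assume "0 \<le> t"
  obtain b where b: "e t < b" "\<And>r. e t < r \<Longrightarrow> r < b \<Longrightarrow> x r = x (e t)"
    using x e(1)[of t] unfolding right_continuous_path_def eventually_at_right_field by blast
  have "\<forall>\<^sub>F r in at_right t. e r < b"
    using e(3)[of t] b(1) by (rule order_tendstoD)
  moreover have "\<forall>\<^sub>F r in at_right t. t < r"
    by (rule eventually_at_right_less)
  ultimately show "\<forall>\<^sub>F r in at_right t. x (e r) = x (e t)"
    by eventually_elim (metis b(2) e(2) less_eq_real_def)
qed

text \<open>Adding 1 to the floor keeps the point strictly above \<open>x\<close> even for dyadic
  \<open>x\<close>, so the approach is from the right; at each level only countably many values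
  occur.\<close>

definition dyadic_above :: "nat \<Rightarrow> real \<Rightarrow> real" where
  "dyadic_above k x = (of_int \<lfloor>x * 2 ^ k\<rfloor> + 1) / 2 ^ k"

lemma dyadic_above_greater: "x < dyadic_above k x"
proof -
  have "x * 2 ^ k < of_int \<lfloor>x * 2 ^ k\<rfloor> + 1" by linarith
  then show ?thesis by (simp add: dyadic_above_def pos_less_divide_eq)
qed

lemma dyadic_above_le: "dyadic_above k x \<le> x + 1 / 2 ^ k"
proof -
  have "of_int \<lfloor>x * 2 ^ k\<rfloor> + 1 \<le> x * 2 ^ k + 1" by simp
  then show ?thesis by (simp add: dyadic_above_def field_simps)
qed

lemma dyadic_above_tendsto: "filterlim (\<lambda>k. dyadic_above k x) (at_right x) sequentially"
  unfolding filterlim_at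
proof
  show "\<forall>\<^sub>F k in sequentially. dyadic_above k x \<in> {x<..} \<and> dyadic_above k x \<noteq> x"
    using dyadic_above_greater[of x] by (auto simp: less_imp_neq[symmetric])
  show "(\<lambda>k. dyadic_above k x) \<longlonglongrightarrow> x"
  proof (rule tendsto_sandwich[OF _ _ tendsto_const])
    show "(\<lambda>k. x + 1 / 2 ^ k) \<longlonglongrightarrow> x"
      by real_asymp
  qed (simp_all add: less_imp_le[OF dyadic_above_greater] dyadic_above_le)
qed

lemma right_continuous_path_dyadic:
  assumes "right_continuous_path x" "0 \<le> t"
  shows "\<forall>\<^sub>F k in sequentially. x (dyadic_above k t) = x t"
proof -
  have "\<forall>\<^sub>F r in at_right t. x r = x t"
    using assms by (simp add: right_continuous_path_def)
  then show ?thesis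
    using dyadic_above_tendsto by (rule eventually_compose_filterlim)
qed

lemma (in finite_measure) measure_tendsto_eventually:
  assumes [measurable]: "\<And>k. A k \<in> sets M" "B \<in> sets M"
    and ae: "AE \<omega> in M. \<forall>\<^sub>F k in sequentially. \<omega> \<in> A k \<longleftrightarrow> \<omega> \<in> B"
  shows "(\<lambda>k. measure M (A k)) \<longlonglongrightarrow> measure M B"
proof -
  have "(\<lambda>k. \<integral>\<omega>. indicator (A k) \<omega> \<partial>M) \<longlonglongrightarrow> (\<integral>\<omega>. indicator B \<omega> \<partial>M :: real)"
  proof (rule integral_dominated_convergence[where w="\<lambda>_. 1"])
    show "AE \<omega> in M. (\<lambda>k. indicator (A k) \<omega> :: real) \<longlonglongrightarrow> indicator B \<omega>"
      using ae
    proof eventually_elim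
      case (elim \<omega>)
      then have "\<forall>\<^sub>F k in sequentially. (indicator (A k) \<omega> :: real) = indicator B \<omega>"
        by eventually_elim (simp add: indicator_def)
      then show ?case by (rule tendsto_eventually)
    qed
  qed (auto simp: indicator_def)
  moreover have "A k \<inter> space M = A k" "B \<inter> space M = B" for k
    using sets.sets_into_space[OF assms(1)] sets.sets_into_space[OF assms(2)] by auto
  ultimately show ?thesis by simp
qed

text \<open>
  At the approximated times only countably many values of \<open>X\<close> matter, so Fubini's theorem applies
  to the joint law of the two processes although \<open>X\<close> need not be jointly measurable.
\<close>

lemma (in prob_space) subordinated_two_point:
  fixes X :: "real \<Rightarrow> 'a \<Rightarrow> nat" and E :: "real \<Rightarrow> 'a \<Rightarrow> real"
  assumes indep: "indep_processes M (\<lambda>t \<omega>. real (X t \<omega>)) E"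
    and X_path: "AE \<omega> in completion M. right_continuous_path (\<lambda>t. X t \<omega>)"
    and E_pos: "AE \<omega> in completion M. 0 \<le> E s \<omega> \<and> E s \<omega> \<le> E t \<omega>"
    and st: "0 \<le> s" "0 \<le> t"
    and p: "\<And>a b. 0 \<le> a \<Longrightarrow> a \<le> b \<Longrightarrow>
      measure (completion M) {\<omega> \<in> space M. X a \<omega> = m \<and> X b \<omega> = n} = p a b"
    and p_meas: "(\<lambda>\<omega>. p (E s \<omega>) (E t \<omega>)) \<in> borel_measurable (completion M)"
  shows "measure (completion M) {\<omega> \<in> space M. X (E s \<omega>) \<omega> = m \<and> X (E t \<omega>) \<omega> = n}
    = (\<integral>\<omega>. p (E s \<omega>) (E t \<omega>) \<partial>completion M)"
proof -
  let ?C = "completion M"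
  interpret C: prob_space ?C by (rule prob_space_completion)
  let ?F = "PiM {0..} (\<lambda>_. borel) :: (real \<Rightarrow> real) measure"
  let ?X = "\<lambda>\<omega>. \<lambda>t\<in>{0..}. real (X t \<omega>)" and ?E = "\<lambda>\<omega>. \<lambda>t\<in>{0..}. E t \<omega>"
  have X[measurable]: "?X \<in> ?C \<rightarrow>\<^sub>M ?F" and E[measurable]: "?E \<in> ?C \<rightarrow>\<^sub>M ?F"
    and joint: "distr ?C ?F ?X \<Otimes>\<^sub>M distr ?C ?F ?E = distr ?C (?F \<Otimes>\<^sub>M ?F) (\<lambda>\<omega>. (?X \<omega>, ?E \<omega>))"
    using indep unfolding indep_processes_def C.indep_var_distribution_eq by auto
  let ?LX = "distr ?C ?F ?X" and ?LE = "distr ?C ?F ?E"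
  interpret LX: prob_space ?LX by (rule C.prob_space_distr[OF X])
  interpret LE: prob_space ?LE by (rule C.prob_space_distr[OF E])
  have X_meas[measurable]: "(\<lambda>\<omega>. real (X r \<omega>)) \<in> borel_measurable ?C" if "0 \<le> r" for r
    using measurable_compose[OF X measurable_component_singleton[of r "{0..}"]] that by simp
  have E_meas[measurable]: "E s \<in> borel_measurable ?C" "E t \<in> borel_measurable ?C"
    using measurable_compose[OF E measurable_component_singleton[of s "{0..}"]]
      measurable_compose[OF E measurable_component_singleton[of t "{0..}"]] st by simp_all
  \<comment> \<open>The truncation keeps every approximating time inside the index set of the
    product space, whatever the value of \<open>E\<close> on a null set.\<close>
  define d where "d k r = max 0 (dyadic_above k r)" for k r
  define A where "A k = {\<omega> \<in> space M. X (d k (E s \<omega>)) \<omega> = m \<and> X (d k (E t \<omega>)) \<omega> = n}" for k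
  define A' where "A' = {\<omega> \<in> space M. X (E s \<omega>) \<omega> = m \<and> X (E t \<omega>) \<omega> = n}"
  \<comment> \<open>\<open>q\<close> is defined at all pairs of times, and Fubini makes it
    measurable along the approximations; \<open>p\<close> is tied to the process only for
    \<open>0 \<le> a \<le> b\<close>. The two meet in the limit.\<close>
  define q where "q a b = measure ?C {\<omega> \<in> space M. X a \<omega> = m \<and> X b \<omega> = n}" for a b
  \<comment> \<open>The evaluation time depends on the second path through an integer only, so
    measurability reduces to countably many coordinate maps.\<close>
  have eval: "(\<lambda>z. fst z (d k (snd z r))) \<in> borel_measurable (?F \<Otimes>\<^sub>M ?F)" if "0 \<le> r" for k r
  proof -
    have "(\<lambda>z. fst z (max 0 ((of_int i + 1) / 2 ^ k))) \<in> borel_measurable (?F \<Otimes>\<^sub>M ?F)" for i :: int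
      by (intro measurable_compose[OF measurable_fst measurable_component_singleton]) auto
    moreover have "(\<lambda>z. \<lfloor>snd z r * 2 ^ k\<rfloor>) \<in> (?F \<Otimes>\<^sub>M ?F) \<rightarrow>\<^sub>M count_space UNIV"
    proof -
      have [measurable]: "(\<lambda>z. snd z r) \<in> borel_measurable (?F \<Otimes>\<^sub>M ?F)"
        using that by (intro measurable_compose[OF measurable_snd measurable_component_singleton]) auto
      show ?thesis by measurable
    qed
    ultimately show ?thesis
      unfolding d_def dyadic_above_def by (rule measurable_compose_countable)
  qed
  let ?S = "\<lambda>k. {z \<in> space (?F \<Otimes>\<^sub>M ?F). fst z (d k (snd z s)) = real m \<and> fst z (d k (snd z t)) = real n}"
  have S[measurable]: "?S k \<in> sets (?F \<Otimes>\<^sub>M ?F)" for k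
  proof -
    note [measurable] = eval[OF st(1)] eval[OF st(2)]
    show ?thesis by measurable
  qed
  have space: "?X \<omega> \<in> space ?F" "?E \<omega> \<in> space ?F" for \<omega>
    by (auto simp: space_PiM)
  have d_nonneg: "0 \<le> d k r" for k r
    by (simp add: d_def)
  have A_eq: "A k = (\<lambda>\<omega>. (?X \<omega>, ?E \<omega>)) -` ?S k \<inter> space ?C" for k
    using space st d_nonneg by (auto simp: A_def space_pair_measure)
  have A_sets[measurable]: "A k \<in> sets ?C" for k
    unfolding A_eq by (rule measurable_sets[OF _ S]) measurable
  have A_prob: "measure ?C (A k) = (\<integral>\<omega>. q (d k (E s \<omega>)) (d k (E t \<omega>)) \<partial>?C)"
    and q_meas: "(\<lambda>\<omega>. q (d k (E s \<omega>)) (d k (E t \<omega>))) \<in> borel_measurable ?C" for k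
  proof -
    interpret LXE: pair_prob_space ?LX ?LE ..
    have S'[measurable]: "?S k \<in> sets (?LX \<Otimes>\<^sub>M ?LE)"
      using S by (simp cong: sets_pair_measure_cong)
    let ?slice = "\<lambda>e. emeasure ?LX ((\<lambda>x. (x, e)) -` ?S k)"
    have slice_meas: "?slice \<in> borel_measurable ?F"
      using LXE.measurable_emeasure_Pair2[OF S'] by simp
    have slice: "?slice (?E \<omega>) = ennreal (q (d k (E s \<omega>)) (d k (E t \<omega>)))" for \<omega>
    proof -
      have "?slice (?E \<omega>) = emeasure ?C (?X -` ((\<lambda>x. (x, ?E \<omega>)) -` ?S k) \<inter> space ?C)"
        by (rule emeasure_distr[OF X sets_Pair2[OF S]])
      also have "?X -` ((\<lambda>x. (x, ?E \<omega>)) -` ?S k) \<inter> space ?C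
          = {\<omega>' \<in> space M. X (d k (E s \<omega>)) \<omega>' = m \<and> X (d k (E t \<omega>)) \<omega>' = n}"
        using space st d_nonneg by (auto simp: space_pair_measure)
      finally show ?thesis by (simp only: q_def C.emeasure_eq_measure)
    qed
    have "(\<lambda>\<omega>. enn2real (?slice (?E \<omega>))) \<in> borel_measurable ?C"
      by (rule measurable_compose[OF measurable_compose[OF E slice_meas]]) measurable
    then show q_meas: "(\<lambda>\<omega>. q (d k (E s \<omega>)) (d k (E t \<omega>))) \<in> borel_measurable ?C"
      unfolding slice by (simp add: q_def)
    have "ennreal (measure ?C (A k)) = emeasure (?LX \<Otimes>\<^sub>M ?LE) (?S k)"
      unfolding joint A_eq C.emeasure_eq_measure[symmetric] by (rule emeasure_distr[symmetric]) measurable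
    also have "\<dots> = (\<integral>\<^sup>+e. ?slice e \<partial>?LE)"
      by (rule LXE.emeasure_pair_measure_alt2[OF S'])
    also have "\<dots> = (\<integral>\<^sup>+\<omega>. ?slice (?E \<omega>) \<partial>?C)"
      by (rule nn_integral_distr[OF E]) (use slice_meas in simp)
    also have "\<dots> = ennreal (\<integral>\<omega>. q (d k (E s \<omega>)) (d k (E t \<omega>)) \<partial>?C)"
      unfolding slice
      by (rule nn_integral_eq_integral)
         (auto simp: q_def intro!: C.integrable_const_bound[where B=1] q_meas[unfolded q_def])
    finally show "measure ?C (A k) = (\<integral>\<omega>. q (d k (E s \<omega>)) (d k (E t \<omega>)) \<partial>?C)"
      by (subst (asm) ennreal_inj) (auto simp: q_def intro!: Bochner_Integration.integral_nonneg)
  qed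
  have limA: "AE \<omega> in ?C. \<forall>\<^sub>F k in sequentially. \<omega> \<in> A k \<longleftrightarrow> \<omega> \<in> A'"
    using X_path E_pos AE_space
  proof eventually_elim
    case (elim \<omega>)
    have "\<forall>\<^sub>F k in sequentially. X (dyadic_above k (E s \<omega>)) \<omega> = X (E s \<omega>) \<omega>"
      "\<forall>\<^sub>F k in sequentially. X (dyadic_above k (E t \<omega>)) \<omega> = X (E t \<omega>) \<omega>"
      using elim by (auto intro!: right_continuous_path_dyadic[where x="\<lambda>r. X r \<omega>"])
    then show ?case
    proof eventually_elim
      case (elim k)
      have "d k (E s \<omega>) = dyadic_above k (E s \<omega>)" "d k (E t \<omega>) = dyadic_above k (E t \<omega>)"
        using dyadic_above_greater[of "E s \<omega>" k] dyadic_above_greater[of "E t \<omega>" k] \<open>0 \<le> E s \<omega> \<and> E s \<omega> \<le> E t \<omega>\<close>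
        by (auto simp: d_def)
      then show ?case using elim by (simp add: A_def A'_def)
    qed
  qed
  \<comment> \<open>\<open>A'\<close> involves uncountably many values of \<open>X\<close>. Up to a
    null set it is the limes inferior of the sets \<open>A k\<close>, hence an event of the
    completion.\<close>
  have A'_sets: "A' \<in> sets ?C"
  proof (rule completion.in_sets_AE)
    show "AE \<omega> in ?C. \<omega> \<in> (\<Union>j. \<Inter>k\<in>{j..}. A k) \<longleftrightarrow> \<omega> \<in> A'"
      using limA
    proof eventually_elim
      case (elim \<omega>)
      then obtain j where j: "\<And>k. j \<le> k \<Longrightarrow> \<omega> \<in> A k \<longleftrightarrow> \<omega> \<in> A'"
        unfolding eventually_sequentially by auto
      show ?case
      proof
        assume "\<omega> \<in> (\<Union>j. \<Inter>k\<in>{j..}. A k)"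
        then obtain i where "\<And>k. i \<le> k \<Longrightarrow> \<omega> \<in> A k" by auto
        then show "\<omega> \<in> A'" using j[of "max i j"] by simp
      qed (use j in auto)
    qed
    show "(\<Union>j. \<Inter>k\<in>{j..}. A k) \<in> sets ?C"
      by (intro sets.countable_UN sets.countable_INT') (auto simp: A_sets)
  qed (auto simp: A'_def)
  have "(\<lambda>k. measure ?C (A k)) \<longlonglongrightarrow> measure ?C A'"
    by (rule C.measure_tendsto_eventually[OF A_sets A'_sets limA])
  moreover have "(\<lambda>k. \<integral>\<omega>. q (d k (E s \<omega>)) (d k (E t \<omega>)) \<partial>?C) \<longlonglongrightarrow> (\<integral>\<omega>. p (E s \<omega>) (E t \<omega>) \<partial>?C)"
  proof (rule integral_dominated_convergence[where w="\<lambda>_. 1"])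
    show "AE \<omega> in ?C. (\<lambda>k. q (d k (E s \<omega>)) (d k (E t \<omega>))) \<longlonglongrightarrow> p (E s \<omega>) (E t \<omega>)"
      using E_pos
    proof eventually_elim
      case (elim \<omega>)
      let ?a = "E s \<omega>" and ?b = "E t \<omega>"
      have ab: "0 \<le> ?a" "?a \<le> ?b" "0 \<le> ?b" using elim by auto
      have sets: "{\<omega> \<in> space M. X a \<omega> = m \<and> X b \<omega> = n} \<in> sets ?C" if "0 \<le> a" "0 \<le> b" for a b
      proof -
        have [measurable]: "(\<lambda>\<omega>. real (X a \<omega>)) \<in> borel_measurable ?C" "(\<lambda>\<omega>. real (X b \<omega>)) \<in> borel_measurable ?C"
          using that by (auto intro: X_meas)
        have "{\<omega> \<in> space M. X a \<omega> = m \<and> X b \<omega> = n} = {\<omega> \<in> space ?C. real (X a \<omega>) = real m \<and> real (X b \<omega>) = real n}"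
          by auto
        also have "\<dots> \<in> sets ?C" by measurable
        finally show ?thesis .
      qed
      have d: "d k r = dyadic_above k r" if "0 \<le> r" for k r
        using dyadic_above_greater[of r k] that by (simp add: d_def)
      \<comment> \<open>With the times \<open>?a\<close> and \<open>?b\<close> frozen,
        right-continuity is used at a second sample point, the one over which \<open>q\<close>
        integrates.\<close>
      have "(\<lambda>k. q (d k ?a) (d k ?b)) \<longlonglongrightarrow> q ?a ?b"
        unfolding q_def
      proof (rule C.measure_tendsto_eventually[OF sets[OF d_nonneg d_nonneg] sets[OF ab(1,3)]])
        show "AE \<omega>' in ?C. \<forall>\<^sub>F k in sequentially.
            \<omega>' \<in> {\<omega> \<in> space M. X (d k ?a) \<omega> = m \<and> X (d k ?b) \<omega> = n}
            \<longleftrightarrow> \<omega>' \<in> {\<omega> \<in> space M. X ?a \<omega> = m \<and> X ?b \<omega> = n}"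
          using X_path
        proof eventually_elim
          case (elim \<omega>')
          have "\<forall>\<^sub>F k in sequentially. X (dyadic_above k ?a) \<omega>' = X ?a \<omega>'"
            "\<forall>\<^sub>F k in sequentially. X (dyadic_above k ?b) \<omega>' = X ?b \<omega>'"
            using elim ab by (auto intro!: right_continuous_path_dyadic[where x="\<lambda>r. X r \<omega>'"])
          then show ?case
            by eventually_elim (simp add: d ab)
        qed
      qed
      then show ?case using p[OF ab(1,2)] by (simp add: q_def)
    qed
  qed (auto simp: q_meas p_meas, simp add: q_def)
  ultimately show ?thesis
    unfolding A_prob A'_def by (rule LIMSEQ_unique)
qed

subsection \<open>The waiting time law of the time-changed process\<close>

context
  fixes \<nu> :: "real measure" and b :: real
  assumes levy: "levy_measure \<nu>" and infinite: "emeasure \<nu> {0<..} = \<infinity>" and b: "0 \<le> b"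
begin

lemma space_levy_measure: "space \<nu> = {0<..}"
  using levy sets_eq_imp_space_eq[of \<nu> "restrict_space borel {0<..}"]
  by (simp add: levy_measure_def space_restrict_space)

lemma measurable_levy_measure: "g \<in> borel_measurable borel \<Longrightarrow> g \<in> borel_measurable \<nu>"
  using levy by (simp add: levy_measure_def measurable_restrict_space1 cong: measurable_cong_sets)

lemma integrable_levy_measure:
  assumes "0 < x"
  shows "integrable \<nu> (\<lambda>y. 1 - exp (- x * y))"
proof (rule Bochner_Integration.integrable_bound)
  have [measurable]: "(\<lambda>y. min y 1) \<in> borel_measurable \<nu>" by (rule measurable_levy_measure) measurable
  have "integrable \<nu> (\<lambda>y. min y 1)"
  proof (rule integrableI_nonneg)
    show "AE y in \<nu>. 0 \<le> min y 1" by (rule AE_I2) (simp add: space_levy_measure)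
    show "(\<integral>\<^sup>+ y. ennreal (min y 1) \<partial>\<nu>) < \<infinity>" using levy by (simp add: levy_measure_def)
  qed measurable
  then show "integrable \<nu> (\<lambda>y. max 1 x * min y 1)" by simp
  show "(\<lambda>y. 1 - exp (- x * y)) \<in> borel_measurable \<nu>" by (rule measurable_levy_measure) measurable
  show "AE y in \<nu>. norm (1 - exp (- x * y)) \<le> norm (max 1 x * min y 1)"
  proof (rule AE_I2)
    fix y assume "y \<in> space \<nu>"
    then have y: "0 < y" by (simp add: space_levy_measure)
    have "1 - exp (- x * y) \<le> x * y" using exp_ge_add_one_self[of "- x * y"] by simp
    also have "x * y \<le> max 1 x * y" using y by (intro mult_right_mono) auto
    finally have 1: "1 - exp (- x * y) \<le> max 1 x * y" .
    have "1 - exp (- x * y) \<le> max 1 x" by (simp add: le_max_iff_disj)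
    with 1 have "1 - exp (- x * y) \<le> max 1 x * min y 1" by (simp add: min_def)
    moreover have "exp (- x * y) \<le> 1" "0 \<le> max 1 x * min y 1" using assms y by auto
    ultimately show "norm (1 - exp (- x * y)) \<le> norm (max 1 x * min y 1)" by simp
  qed
qed

text \<open>The integrand is strictly positive on all of \<open>space \<nu>\<close>, so a vanishing
  integral would force \<open>\<nu>\<close> to be the zero measure.\<close>

lemma bernstein_function_pos:
  assumes "0 < x"
  shows "0 < bernstein_function b \<nu> x"
proof -
  have nonneg: "AE y in \<nu>. 0 \<le> 1 - exp (- x * y)"
    by (rule AE_I2) (use assms in \<open>simp add: space_levy_measure\<close>)
  have "(\<integral>y. 1 - exp (- x * y) \<partial>\<nu>) \<noteq> 0"
  proof
    assume "(\<integral>y. 1 - exp (- x * y) \<partial>\<nu>) = 0"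
    then have "AE y in \<nu>. 1 - exp (- x * y) = 0"
      using integral_nonneg_eq_0_iff_AE[OF integrable_levy_measure[OF assms] nonneg] by simp
    then have "AE y in \<nu>. False"
      using AE_space by eventually_elim (use assms in \<open>simp add: space_levy_measure\<close>)
    then have "emeasure \<nu> {y \<in> space \<nu>. True} = 0" by (intro emeasure_eq_0_AE) simp
    moreover have "{y \<in> space \<nu>. True} = {0<..}" by (auto simp: space_levy_measure)
    ultimately show False using infinite by simp
  qed
  moreover have "0 \<le> (\<integral>y. 1 - exp (- x * y) \<partial>\<nu>)"
    using nonneg by (rule Bochner_Integration.integral_nonneg_AE)
  moreover have "0 \<le> b * x" using b assms by simp
  ultimately show ?thesis unfolding bernstein_function_def by linarith
qed

text \<open>By monotone convergence along integer arguments the integrals tend to the total mass of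
  \<open>\<nu>\<close>, which is infinite. This is the source of strictly increasing paths and so of
  the absence of atoms in \<open>dF\<close>.\<close>

lemma bernstein_function_unbounded: "\<exists>x>0. C < bernstein_function b \<nu> x"
proof -
  let ?g = "\<lambda>k y. ennreal (1 - exp (- real (Suc k) * y))"
  have "(\<integral>\<^sup>+y. (SUP k. ?g k y) \<partial>\<nu>) = (SUP k. \<integral>\<^sup>+y. ?g k y \<partial>\<nu>)"
  proof (rule nn_integral_monotone_convergence_SUP_AE)
    show "AE y in \<nu>. ?g k y \<le> ?g (Suc k) y" for k
      by (rule AE_I2) (auto intro!: ennreal_leI simp: space_levy_measure)
    show "?g k \<in> borel_measurable \<nu>" for k by (rule measurable_levy_measure) measurable
  qed
  moreover have "(\<integral>\<^sup>+y. (SUP k. ?g k y) \<partial>\<nu>) = (\<integral>\<^sup>+y. 1 \<partial>\<nu>)"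
  proof (rule nn_integral_cong)
    fix y assume "y \<in> space \<nu>"
    then have y: "0 < y" by (simp add: space_levy_measure)
    have "(\<lambda>k. 1 - exp (- real (Suc k) * y)) \<longlonglongrightarrow> 1"
      using y by real_asymp
    then have "(\<lambda>k. ?g k y) \<longlonglongrightarrow> ennreal 1" by (rule tendsto_ennrealI)
    moreover have "incseq (\<lambda>k. ?g k y)"
      by (rule incseq_SucI) (use y in \<open>auto intro!: ennreal_leI\<close>)
    ultimately show "(SUP k. ?g k y) = 1"
      using LIMSEQ_SUP LIMSEQ_unique ennreal_1 by metis
  qed
  ultimately have "(SUP k. \<integral>\<^sup>+y. ?g k y \<partial>\<nu>) = \<infinity>"
    using infinite by (simp add: space_levy_measure)
  then have "ennreal (max 0 C) < (SUP k. \<integral>\<^sup>+y. ?g k y \<partial>\<nu>)"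
    by (simp only: infinity_ennreal_def ennreal_less_top)
  then obtain k where k: "ennreal (max 0 C) < (\<integral>\<^sup>+y. ?g k y \<partial>\<nu>)"
    by (auto simp: less_SUP_iff)
  let ?I = "\<integral>y. 1 - exp (- real (Suc k) * y) \<partial>\<nu>"
  have "(\<integral>\<^sup>+y. ?g k y \<partial>\<nu>) = ennreal (\<integral>y. 1 - exp (- real (Suc k) * y) \<partial>\<nu>)"
    by (rule nn_integral_eq_integral[OF integrable_levy_measure])
      (auto intro!: AE_I2 mult_nonpos_nonneg simp: space_levy_measure)
  with k have "ennreal (max 0 C) < ennreal ?I" by (simp only:)
  then have "\<not> ?I \<le> max 0 C" using ennreal_leI[of ?I "max 0 C"] by (meson not_le)
  then have "C < ?I" by linarith
  moreover have "0 \<le> b * real (Suc k)" using b by simp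
  ultimately have "C < bernstein_function b \<nu> (real (Suc k))"
    unfolding bernstein_function_def by linarith
  then show ?thesis by (intro exI[of _ "real (Suc k)"]) simp
qed

end

section \<open>The mixed exponential law: distribution function and atoms\<close>

context unbounded_subordinator
begin

lemma bind_return_0: "return borel 0 \<bind> K = return borel 0"
proof -
  interpret R: nonneg_law "return borel (0::real)" by (rule nonneg_law_return) simp
  show ?thesis using convolution_power_bind[OF R.nonneg_law_axioms, of 0] by simp
qed

text \<open>The case of \<open>expectation_joint_prob\<close> in which the gap is the point mass at
  0: \<open>D\<close> at an independent exponential time is at most \<open>c\<close> when that time
  is at most \<open>E c\<close>.\<close>

lemma cdf_exponential_bind:
  assumes l: "0 < l" and c: "0 \<le> c"
  shows "measure (exponential_law l \<bind> K) {..c} = 1 - (\<integral>\<omega>. exp (- l * E c \<omega>) \<partial>completion M)"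
proof -
  let ?X = "exponential_law l"
  interpret X: nonneg_law ?X by (rule nonneg_law_exponential[OF l])
  interpret XK: nonneg_law "?X \<bind> K" by (rule nonneg_law_bind[OF X.nonneg_law_axioms])
  interpret R: nonneg_law "return borel (0::real)" by (rule nonneg_law_return) simp
  interpret C: prob_space "completion M" by (rule prob_space_completion)
  have [measurable]: "E c \<in> borel_measurable (completion M)" using c by (rule measurable_E)
  have "measure (?X \<bind> K) {..c} = joint_prob (?X \<bind> K) (return borel 0 \<bind> K) c c"
    by (simp add: joint_prob_return[OF XK.nonneg_law_axioms order_refl] bind_return_0)
  also have "\<dots> = (\<integral>\<omega>. measure ?X {..E c \<omega>} \<partial>completion M)"
    using expectation_joint_prob(2)[OF X.nonneg_law_axioms R.nonneg_law_axioms c order_refl]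
    by (simp add: joint_prob_return[OF X.nonneg_law_axioms order_refl])
  also have "\<dots> = (\<integral>\<omega>. 1 - exp (- l * E c \<omega>) \<partial>completion M)"
  proof (rule integral_cong_AE)
    show "AE \<omega> in completion M. measure ?X {..E c \<omega>} = 1 - exp (- l * E c \<omega>)"
      using AE_completion[OF E_nonneg]
    proof eventually_elim
      case (elim \<omega>)
      then show ?case
        using X.measure_greaterThan[of "E c \<omega>"] by (simp add: measure_exponential_law_greaterThan[OF l])
    qed
    show "(\<lambda>\<omega>. measure ?X {..E c \<omega>}) \<in> borel_measurable (completion M)"
      by (rule measurable_compose[OF _ X.cdf_measurable]) measurable
  qed measurable
  also have "\<dots> = 1 - (\<integral>\<omega>. exp (- l * E c \<omega>) \<partial>completion M)"
  proof (subst Bochner_Integration.integral_diff)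
    show "integrable (completion M) (\<lambda>\<omega>. exp (- l * E c \<omega>))"
      by (rule C.integrable_const_bound[where B=1])
         (use AE_completion[OF E_nonneg] l in \<open>auto elim!: eventually_mono\<close>)
  qed (use C.prob_space in simp_all)
  finally show ?thesis .
qed

lemma stieltjes_measure_eq:
  assumes l: "0 < l" and F: "\<And>r. 0 \<le> r \<Longrightarrow> F r = 1 - (\<integral>\<omega>. exp (- l * E r \<omega>) \<partial>completion M)"
  shows "stieltjes_measure F = exponential_law l \<bind> K"
proof -
  interpret XK: nonneg_law "exponential_law l \<bind> K"
    by (rule nonneg_law_bind[OF nonneg_law_exponential[OF l]])
  interpret XK: real_distribution "exponential_law l \<bind> K" by (rule XK.real_distribution)
  have "(\<lambda>x. if x < 0 then 0 else F x) = cdf (exponential_law l \<bind> K)"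
  proof
    fix x
    show "(if x < 0 then 0 else F x) = cdf (exponential_law l \<bind> K) x"
    proof (cases "x < 0")
      case True
      then have "XK.prob {..x} = 0"
        by (subst XK.prob_eq_0) (use XK.nonneg in \<open>auto elim!: eventually_mono\<close>)
      then show ?thesis using True by (simp add: cdf_def)
    qed (simp add: F cdf_def cdf_exponential_bind[OF l])
  qed
  then have "stieltjes_measure F = interval_measure (cdf (exponential_law l \<bind> K))"
    by (simp add: stieltjes_measure_def)
  also have "\<dots> = exponential_law l \<bind> K"
  proof (rule cdf_unique)
    show "real_distribution (interval_measure (cdf (exponential_law l \<bind> K)))"
      by (rule real_distribution_interval_measure)
         (auto intro: XK.cdf_nondecreasing XK.cdf_is_right_cont XK.cdf_lim_at_bot XK.cdf_lim_at_top_prob)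
    show "cdf (interval_measure (cdf (exponential_law l \<bind> K))) = cdf (exponential_law l \<bind> K)"
      by (rule cdf_interval_measure)
         (auto intro: XK.cdf_nondecreasing XK.cdf_is_right_cont XK.cdf_lim_at_bot)
  qed (rule XK.real_distribution)
  finally show ?thesis .
qed

text \<open>The probability of \<open>D h \<le> 0\<close> is at most
  \<open>exp (- h * \<psi> x)\<close> for every positive \<open>x\<close>, thus 0 for an unbounded
  exponent; stationarity carries this over to the increment from \<open>r\<close> to
  \<open>r + h\<close>.\<close>

lemma D_increasing:
  assumes unbounded: "\<And>C. \<exists>x>0. C < \<psi> x" and r: "0 \<le> r" "0 < h"
  shows "AE \<omega> in M. D r \<omega> < D (r + h) \<omega>"
proof -
  have [measurable]: "D h \<in> borel_measurable M" "D r \<in> borel_measurable M" "D (r + h) \<in> borel_measurable M"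
    using r by auto
  have le: "prob {\<omega> \<in> space M. D h \<omega> \<le> 0} \<le> exp (- h * C)" for C
  proof -
    obtain x where x: "0 < x" "C < \<psi> x" using unbounded by blast
    have "prob {\<omega> \<in> space M. D h \<omega> \<le> 0} = (\<integral>\<omega>. indicator {\<omega> \<in> space M. D h \<omega> \<le> 0} \<omega> \<partial>M)"
      by simp
    also have "\<dots> \<le> (\<integral>\<omega>. exp (- x * D h \<omega>) \<partial>M)"
    proof (rule integral_mono)
      show "integrable M (indicator {\<omega> \<in> space M. D h \<omega> \<le> 0} :: _ \<Rightarrow> real)"
        by (rule integrable_const_bound[where B=1]) (auto simp: indicator_def)
      show "integrable M (\<lambda>\<omega>. exp (- x * D h \<omega>))" using r x by (intro integrable_exp_D) auto
    qed (use x in \<open>auto simp: indicator_def mult_le_0_iff\<close>)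
    also have "\<dots> = exp (- h * \<psi> x)" using laplace_D[of h x] r x by simp
    also have "\<dots> \<le> exp (- h * C)" using r x by simp
    finally show ?thesis .
  qed
  have "(\<lambda>n. exp (- h * real n)) \<longlonglongrightarrow> 0" using r by real_asymp
  then have "prob {\<omega> \<in> space M. D h \<omega> \<le> 0} \<le> 0"
    by (rule LIMSEQ_le_const) (use le in auto)
  moreover have "prob {\<omega> \<in> space M. D h \<omega> \<le> 0} = prob {\<omega> \<in> space M. D (r + h) \<omega> - D r \<omega> \<le> 0}"
  proof -
    have "distr M borel (\<lambda>\<omega>. D (r + h) \<omega> - D r \<omega>) = distr M borel (D h)"
      using D_stationary r by (simp add: stationary_increments_def)
    then have "measure (distr M borel (\<lambda>\<omega>. D (r + h) \<omega> - D r \<omega>)) {..0} = measure (distr M borel (D h)) {..0}"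
      by simp
    then show ?thesis by (simp add: measure_distr vimage_def Int_def conj_commute)
  qed
  ultimately have "prob {\<omega> \<in> space M. D (r + h) \<omega> - D r \<omega> \<le> 0} = 0"
    using measure_nonneg[of M] by (simp add: order_antisym)
  then have "AE \<omega> in M. \<not> D (r + h) \<omega> - D r \<omega> \<le> 0"
    by (subst (asm) prob_Collect_eq_0) auto
  then show ?thesis by eventually_elim auto
qed

text \<open>
  Since \<open>D\<close> increases strictly, \<open>D r = c\<close> forces \<open>E c = r\<close> almost surely, which has positive
  probability for countably many \<open>r\<close> only.
\<close>

lemma exponential_bind_atomless:
  assumes unbounded: "\<And>C. \<exists>x>0. C < \<psi> x" and l: "0 < l" and c: "0 \<le> c"
  shows "measure (exponential_law l \<bind> K) {c} = 0"
proof -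
  let ?X = "exponential_law l"
  interpret X: nonneg_law ?X by (rule nonneg_law_exponential[OF l])
  interpret XK: nonneg_law "?X \<bind> K" by (rule nonneg_law_bind[OF X.nonneg_law_axioms])
  interpret C: prob_space "completion M" by (rule prob_space_completion)
  have E[measurable]: "E c \<in> borel_measurable (completion M)" using c by (rule measurable_E)
  interpret L: real_distribution "distr (completion M) borel (E c)"
    using E by (rule C.real_distribution_distr)
  have le: "measure (K r) {c} \<le> measure (distr (completion M) borel (E c)) {r}" if "0 \<le> r" for r
  proof -
    have [measurable]: "D r \<in> borel_measurable M" using that by auto
    have ae: "AE \<omega> in completion M. D r \<omega> = c \<longrightarrow> E c \<omega> = r"
    proof -
      \<comment> \<open>Countably many later times suffice: each at which \<open>D\<close> exceeds
        \<open>c\<close> bounds \<open>E c\<close> from above, and these times decrease to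
        \<open>r\<close>.\<close>
      have "AE \<omega> in M. \<forall>k::nat. D r \<omega> < D (r + 1 / real (Suc k)) \<omega>"
        unfolding AE_all_countable by (intro allI D_increasing[OF unbounded that]) simp
      then have "AE \<omega> in M. D r \<omega> = c \<longrightarrow> E c \<omega> = r"
        using passage[OF c that]
      proof eventually_elim
        case (elim \<omega>)
        show ?case
        proof
          assume "D r \<omega> = c"
          then have "r \<le> E c \<omega>" using elim(2) by simp
          moreover have "E c \<omega> \<le> r + 1 / real (Suc k)" for k
            using inverse_process_le[of "r + 1 / real (Suc k)" c D \<omega>] elim(1) \<open>D r \<omega> = c\<close> that by auto
          then have "E c \<omega> \<le> r"
            by (intro LIMSEQ_le_const[of "\<lambda>k. r + 1 / real (Suc k)"]) (real_asymp, auto)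
          ultimately show "E c \<omega> = r" by simp
        qed
      qed
      then show ?thesis by (rule AE_completion)
    qed
    have "measure (K r) {c} = prob {\<omega> \<in> space M. D r \<omega> = c}"
      using that by (simp add: K_def measure_distr vimage_def Int_def conj_commute)
    also have "\<dots> = measure (completion M) {\<omega> \<in> space M. D r \<omega> = c}"
      by (rule measure_completion[symmetric]) measurable
    also have "\<dots> \<le> measure (completion M) {\<omega> \<in> space (completion M). E c \<omega> = r}"
    proof (rule C.finite_measure_mono_AE)
      show "AE \<omega> in completion M. \<omega> \<in> {\<omega> \<in> space M. D r \<omega> = c} \<longrightarrow> \<omega> \<in> {\<omega> \<in> space (completion M). E c \<omega> = r}"
        using ae by eventually_elim auto
    qed measurable
    also have "\<dots> = measure (distr (completion M) borel (E c)) {r}"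
      by (simp add: measure_distr vimage_def Int_def conj_commute)
    finally show ?thesis .
  qed
  have "AE r in lborel. r \<notin> {r. 0 < measure (distr (completion M) borel (E c)) {r}}"
    by (rule AE_not_in) (rule countable_imp_null_set_lborel[OF L.countable_atoms])
  then have "AE r in ?X. r \<notin> {r. 0 < measure (distr (completion M) borel (E c)) {r}}"
    unfolding exponential_law_def by (subst AE_density) auto
  then have zero: "AE r in ?X. measure (K r) {c} = 0"
    using X.nonneg
  proof eventually_elim
    case (elim r)
    then show ?case using le[of r] measure_nonneg[of "K r" "{c}"] by (simp add: not_less order_antisym)
  qed
  have "measure (?X \<bind> K) {c} = (\<integral>r. measure (K r) {c} \<partial>?X)"
    by (rule X.measure_bind[where N=borel]) measurable
  also have "\<dots> = 0"
    by (rule integral_eq_zero_AE[OF zero])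
  finally show ?thesis .
qed

end

subsection \<open>The two-point law of the time-changed process\<close>

text \<open>\<open>T\<close> stands for the expectation in the theorem. It equals the survival
  function at nonnegative times, and \<open>u \<le> s \<le> t\<close> keeps \<open>t - u\<close>
  among them.\<close>

lemma set_integral_no_jump:
  assumes Q: "nonneg_law Q" and st: "0 \<le> s" "s \<le> t"
    and T: "\<And>c. 0 \<le> c \<Longrightarrow> T c = measure Q {c<..}"
  shows "(LINT u:{0..s}|convolution_power Q m. T (t - u)) = renewal_prob Q m m s t"
proof -
  interpret Q: nonneg_law Q by fact
  interpret A: nonneg_law "convolution_power Q m" by (rule nonneg_law_convolution_power[OF Q])
  note [measurable] = measurable_compose[OF _ Q.survival_measurable]
  have eq: "indicator {0..s} u *\<^sub>R T (t - u) = indicator {0..s} u * measure Q {t - u<..}" for u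
    using st by (cases "u \<le> s") (auto simp: T indicator_def)
  show ?thesis
    unfolding renewal_prob_no_jump[OF Q st(2)] set_lebesgue_integral_def eq
  proof (rule integral_cong_AE)
    show "AE u in convolution_power Q m. indicator {0..s} u * measure Q {t - u<..} = indicator {..s} u * measure Q {t - u<..}"
      using A.nonneg by eventually_elim (simp add: indicator_def)
  qed measurable
qed

text \<open>The integrals differ from \<open>renewal_prob_jump\<close> on null sets: negative values
  of \<open>u\<close> and \<open>x\<close> have probability 0, and the endpoint
  \<open>v = s - u\<close> is not an atom.\<close>

lemma set_integral_jump:
  assumes Q: "nonneg_law Q" and st: "0 \<le> s" "s \<le> t"
    and atomless: "\<And>c. 0 \<le> c \<Longrightarrow> measure Q {c} = 0"
    and T: "\<And>c. 0 \<le> c \<Longrightarrow> T c = measure Q {c<..}"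
  shows "(LINT u:{0..s}|convolution_power Q m. LINT v:{s - u..t - u}|Q.
      LINT x:{0..t - (u + v)}|convolution_power Q k. T (t - u - v - x)) = renewal_prob Q m (m + 1 + k) s t"
proof -
  interpret Q: nonneg_law Q by fact
  interpret A: nonneg_law "convolution_power Q m" by (rule nonneg_law_convolution_power[OF Q])
  interpret B: nonneg_law "convolution_power Q k" by (rule nonneg_law_convolution_power[OF Q])
  define S where "S c = measure Q {c<..}" for c
  have [measurable]: "S \<in> borel_measurable borel"
    unfolding S_def by (rule Q.survival_measurable)
  define H where "H u v = (\<integral>x. indicator {..t - (u + v)} x * S (t - u - v - x) \<partial>convolution_power Q k)" for u v
  \<comment> \<open>Joint measurability in \<open>u\<close> and \<open>v\<close> makes the integral
    over \<open>v\<close> measurable in \<open>u\<close>, which the almost-everywhere comparison of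
    the outer integrals requires.\<close>
  have H_meas[measurable]: "(\<lambda>(u, v). H u v) \<in> borel_measurable (borel \<Otimes>\<^sub>M borel)"
  proof -
    have "(\<lambda>w. of_bool (snd w \<le> t - (fst (fst w) + snd (fst w))) * S (t - fst (fst w) - snd (fst w) - snd w))
        \<in> borel_measurable ((borel \<Otimes>\<^sub>M borel) \<Otimes>\<^sub>M borel)"
      by measurable
    then have "(\<lambda>z. \<integral>x. of_bool (x \<le> t - (fst z + snd z)) * S (t - fst z - snd z - x) \<partial>convolution_power Q k)
        \<in> borel_measurable (borel \<Otimes>\<^sub>M borel)"
      by (intro B.borel_measurable_lebesgue_integral)
         (simp add: case_prod_beta' measurable_cong_sets[OF sets_pair_measure_cong[OF refl B.sets_P] refl])
    then show ?thesis
      by (simp add: H_def indicator_def case_prod_beta')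
  qed
  have H: "(LINT x:{0..t - (u + v)}|convolution_power Q k. T (t - u - v - x)) = H u v" for u v
  proof -
    have "indicator {0..t - (u + v)} x *\<^sub>R T (t - u - v - x) = indicator {0..t - (u + v)} x * S (t - u - v - x)" for x
      by (cases "x \<le> t - (u + v)") (auto simp: T S_def indicator_def)
    then have "(LINT x:{0..t - (u + v)}|convolution_power Q k. T (t - u - v - x))
        = (\<integral>x. indicator {0..t - (u + v)} x * S (t - u - v - x) \<partial>convolution_power Q k)"
      by (simp only: set_lebesgue_integral_def)
    also have "\<dots> = H u v"
      unfolding H_def
    proof (rule integral_cong_AE)
      show "AE x in convolution_power Q k. indicator {0..t - (u + v)} x * S (t - u - v - x)
          = indicator {..t - (u + v)} x * S (t - u - v - x)"
        using B.nonneg by eventually_elim (simp add: indicator_def)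
    qed measurable
    finally show ?thesis .
  qed
  \<comment> \<open>The restriction \<open>u \<le> s\<close> makes \<open>s - u\<close> nonnegative,
    where \<open>atomless\<close> applies; the outer indicator guarantees it.\<close>
  have G: "(LINT v:{s - u..t - u}|Q. H u v) = (\<integral>v. indicator {s - u<..t - u} v * H u v \<partial>Q)" if "u \<le> s" for u
    unfolding set_lebesgue_integral_def
  proof (rule integral_cong_AE)
    have "AE v in Q. v \<notin> {s - u}"
      using atomless[of "s - u"] that by (intro Q.prob_eq_0[THEN iffD1]) auto
    then show "AE v in Q. indicator {s - u..t - u} v *\<^sub>R H u v = indicator {s - u<..t - u} v * H u v"
      by eventually_elim (auto simp: indicator_def)
  qed measurable
  show ?thesis
    unfolding renewal_prob_jump[OF Q st(2)] H
    unfolding set_lebesgue_integral_def[of "convolution_power Q m"] S_def[symmetric] H_def[symmetric]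
  proof (rule integral_cong_AE)
    show "AE u in convolution_power Q m. indicator {0..s} u *\<^sub>R (LINT v:{s - u..t - u}|Q. H u v)
        = indicator {..s} u * (\<integral>v. indicator {s - u<..t - u} v * H u v \<partial>Q)"
      using A.nonneg
    proof eventually_elim
      case (elim u)
      then show ?case by (cases "u \<le> s") (simp_all add: G)
    qed
    \<comment> \<open>The interval for \<open>v\<close> moves with \<open>u\<close>; as a condition
      on the pair, its indicator is jointly measurable.\<close>
    have [measurable]: "(\<lambda>u. \<integral>v. (if s - u \<le> v \<and> v \<le> t - u then 1 else 0) * H u v \<partial>Q) \<in> borel_measurable borel"
      "(\<lambda>u. \<integral>v. (if s - u < v \<and> v \<le> t - u then 1 else 0) * H u v \<partial>Q) \<in> borel_measurable borel"
      by measurable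
    have "(\<lambda>u. indicator {0..s} u *\<^sub>R (\<integral>v. (if s - u \<le> v \<and> v \<le> t - u then 1 else 0) * H u v \<partial>Q)) \<in> borel_measurable borel"
      by measurable
    then show "(\<lambda>u. indicator {0..s} u *\<^sub>R (LINT v:{s - u..t - u}|Q. H u v)) \<in> borel_measurable (convolution_power Q m)"
      by (simp add: set_lebesgue_integral_def indicator_def of_bool_def measurable_cong_sets[OF A.sets_P refl])
    have "(\<lambda>u. indicator {..s} u * (\<integral>v. (if s - u < v \<and> v \<le> t - u then 1 else 0) * H u v \<partial>Q)) \<in> borel_measurable borel"
      by measurable
    then show "(\<lambda>u. indicator {..s} u * (\<integral>v. indicator {s - u<..t - u} v * H u v \<partial>Q)) \<in> borel_measurable (convolution_power Q m)"
      by (simp add: indicator_def of_bool_def measurable_cong_sets[OF A.sets_P refl])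
  qed
qed

text \<open>One time change in full, applied once inside the fractional Poisson process with
  exponent \<open>x powr \<beta>\<close> and once to that process with exponent
  \<open>f\<close>.\<close>

lemma (in unbounded_subordinator) renewal_subordinated:
  assumes indep: "indep_processes M (\<lambda>t \<omega>. real (X t \<omega>)) E"
    and path: "AE \<omega> in completion M. right_continuous_path (\<lambda>t. X t \<omega>)"
    and Q: "nonneg_law Q" and st: "0 \<le> s" "s \<le> t"
    and renewal: "\<And>a b. 0 \<le> a \<Longrightarrow> a \<le> b \<Longrightarrow>
      measure (completion M) {\<omega> \<in> space M. X a \<omega> = m \<and> X b \<omega> = n} = renewal_prob Q m n a b"
  shows "measure (completion M) {\<omega> \<in> space M. X (E s \<omega>) \<omega> = m \<and> X (E t \<omega>) \<omega> = n}
    = renewal_prob (Q \<bind> K) m n s t"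
proof -
  have "measure (completion M) {\<omega> \<in> space M. X (E s \<omega>) \<omega> = m \<and> X (E t \<omega>) \<omega> = n}
      = (\<integral>\<omega>. renewal_prob Q m n (E s \<omega>) (E t \<omega>) \<partial>completion M)"
  proof (rule subordinated_two_point[OF indep path _ _ _ renewal])
    have "AE \<omega> in M. 0 \<le> E s \<omega> \<and> E s \<omega> \<le> E t \<omega>"
      using E_nonneg E_mono by eventually_elim (use st in simp)
    then show "AE \<omega> in completion M. 0 \<le> E s \<omega> \<and> E s \<omega> \<le> E t \<omega>" by (rule AE_completion)
    show "(\<lambda>\<omega>. renewal_prob Q m n (E s \<omega>) (E t \<omega>)) \<in> borel_measurable (completion M)"
      unfolding renewal_prob_def
      using st by (intro borel_measurable_add borel_measurable_diff measurable_joint_prob_E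
          nonneg_law_convolution_power[OF Q]) auto
  qed (use st in auto)
  then show ?thesis
    using expectation_renewal_prob[OF Q st] by simp
qed

lemma poisson_process_path:
  assumes "poisson_process M l N"
  shows "AE \<omega> in completion M. right_continuous_path (\<lambda>t. N t \<omega>)"
proof (rule AE_completion)
  have "AE \<omega> in M. cadlag (\<lambda>t. real (N t \<omega>))"
    using assms by (simp add: poisson_process_def levy_process_def)
  then show "AE \<omega> in M. right_continuous_path (\<lambda>t. N t \<omega>)"
    by eventually_elim (auto simp: cadlag_def intro!: right_continuous_pathI)
qed

text \<open>Describing \<open>Q\<close> by its transform treats \<open>\<beta> = 1\<close> and
  \<open>\<beta> < 1\<close> alike, since \<open>y powr 1 = y\<close> for positive \<open>y\<close>.
  The path property is exported because the next time change needs it of its outer process.\<close>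

lemma fractional_poisson_process_renewal:
  assumes M: "prob_space M" and \<beta>: "0 < \<beta>" and l: "0 < l"
    and X: "fractional_poisson_process M \<beta> l X"
  obtains Q where "nonneg_law Q"
    and "\<And>y. 0 < y \<Longrightarrow> laplace_transform Q y = laplace_transform (exponential_law l) (y powr \<beta>)"
    and "AE \<omega> in completion M. right_continuous_path (\<lambda>t. X t \<omega>)"
    and "\<And>m n a b. m \<le> n \<Longrightarrow> 0 \<le> a \<Longrightarrow> a \<le> b \<Longrightarrow>
      measure (completion M) {\<omega> \<in> space M. X a \<omega> = m \<and> X b \<omega> = n} = renewal_prob Q m n a b"
proof (cases "\<beta> = 1")
  case True
  then have N: "poisson_process M l X" using X by (simp add: fractional_poisson_process_def)
  show ?thesis
  proof (rule that)
    show "nonneg_law (exponential_law l)" by (rule nonneg_law_exponential[OF l])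
    show "AE \<omega> in completion M. right_continuous_path (\<lambda>t. X t \<omega>)" by (rule poisson_process_path[OF N])
    show "measure (completion M) {\<omega> \<in> space M. X a \<omega> = m \<and> X b \<omega> = n} = renewal_prob (exponential_law l) m n a b"
      if "m \<le> n" "0 \<le> a" "a \<le> b" for m n a b
      by (rule poisson_process_renewal[OF M N l that(2,3,1)])
  qed (use True in simp)
next
  case False
  then obtain N D where N: "poisson_process M l N" and D: "subordinator M (\<lambda>x. x powr \<beta>) D"
    and indep: "indep_processes M (\<lambda>t \<omega>. real (N t \<omega>)) (inverse_process D)"
    and X_eq: "\<And>t \<omega>. 0 \<le> t \<Longrightarrow> \<omega> \<in> space M \<Longrightarrow> X t \<omega> = N (inverse_process D t \<omega>) \<omega>"
    using X by (auto simp: fractional_poisson_process_def)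
  interpret unbounded_subordinator M D "\<lambda>x. x powr \<beta>"
    using M D by (auto simp: unbounded_subordinator_def unbounded_subordinator_axioms_def intro!: exI[of _ 1])
  have Exp: "nonneg_law (exponential_law l)" by (rule nonneg_law_exponential[OF l])
  show ?thesis
  proof (rule that)
    show "nonneg_law (exponential_law l \<bind> K)" by (rule nonneg_law_bind[OF Exp])
    show "laplace_transform (exponential_law l \<bind> K) y = laplace_transform (exponential_law l) (y powr \<beta>)"
      if "0 < y" for y
      by (rule laplace_transform_bind[OF Exp that])
    have "AE \<omega> in M. right_continuous_path (\<lambda>t. N t \<omega>)"
      using poisson_process_path[OF N] by (simp add: AE_completion_iff)
    then have "AE \<omega> in M. right_continuous_path (\<lambda>t. X t \<omega>)"
      using E_nonneg E_mono E_right_continuous AE_space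
    proof eventually_elim
      case (elim \<omega>)
      have path: "right_continuous_path (\<lambda>t. N (E t \<omega>) \<omega>)"
        by (rule right_continuous_path_compose[OF elim(1)]) (use elim in auto)
      \<comment> \<open>\<open>X\<close> agrees with the composed process at nonnegative times only,
        so the neighbourhood is cut down to times after \<open>t\<close>.\<close>
      show ?case
        unfolding right_continuous_path_def
      proof (intro allI impI)
        fix t :: real assume t: "0 \<le> t"
        have "\<forall>\<^sub>F r in at_right t. N (E r \<omega>) \<omega> = N (E t \<omega>) \<omega>"
          using path t by (simp add: right_continuous_path_def)
        moreover have "\<forall>\<^sub>F r in at_right t. t < r" by (rule eventually_at_right_less)
        ultimately show "\<forall>\<^sub>F r in at_right t. X r \<omega> = X t \<omega>"
          by eventually_elim (use t elim(5) in \<open>simp add: X_eq\<close>)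
      qed
    qed
    then show "AE \<omega> in completion M. right_continuous_path (\<lambda>t. X t \<omega>)" by (rule AE_completion)
    show "measure (completion M) {\<omega> \<in> space M. X a \<omega> = m \<and> X b \<omega> = n} = renewal_prob (exponential_law l \<bind> K) m n a b"
      if "m \<le> n" "0 \<le> a" "a \<le> b" for m n a b
    proof -
      have "{\<omega> \<in> space M. X a \<omega> = m \<and> X b \<omega> = n} = {\<omega> \<in> space M. N (E a \<omega>) \<omega> = m \<and> N (E b \<omega>) \<omega> = n}"
        using that by (auto simp: X_eq)
      moreover have "measure (completion M) {\<omega> \<in> space M. N (E a \<omega>) \<omega> = m \<and> N (E b \<omega>) \<omega> = n}
          = renewal_prob (exponential_law l \<bind> K) m n a b"
        by (rule renewal_subordinated[OF indep poisson_process_path[OF N] Exp that(2,3)])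
           (rule poisson_process_renewal[OF M N l _ _ that(1)])
      ultimately show ?thesis by simp
    qed
  qed
qed

theorem theorem4p4:
  fixes M :: "'w measure" and M' :: "'v measure" and \<nu> :: "real measure"
    and \<beta> rate b s t :: real and m n :: nat
    and f \<phi> F :: "real \<Rightarrow> real"
    and N\<^sub>\<beta> W :: "real \<Rightarrow> 'w \<Rightarrow> nat"
    and D\<^sub>f E\<^sub>f :: "real \<Rightarrow> 'w \<Rightarrow> real"
    and D\<^sub>\<phi> E\<^sub>\<phi> :: "real \<Rightarrow> 'v \<Rightarrow> real"
  assumes "prob_space M" and "prob_space M'"
    and "0 < \<beta>" and "\<beta> \<le> 1" and "0 < rate"
    and "0 \<le> b" and "levy_measure \<nu>" and "emeasure \<nu> {0<..} = \<infinity>"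
    and "\<And>x. x > 0 \<Longrightarrow> f x = bernstein_function b \<nu> x"
    and "\<And>x. x > 0 \<Longrightarrow> \<phi> x = f x powr \<beta>"
    and "fractional_poisson_process M \<beta> rate N\<^sub>\<beta>"
    and "subordinator M f D\<^sub>f"
    and "E\<^sub>f = inverse_process D\<^sub>f"
    and "indep_processes M (\<lambda>r \<omega>. real (N\<^sub>\<beta> r \<omega>)) E\<^sub>f"
    and "\<And>r \<omega>. r \<ge> 0 \<Longrightarrow> \<omega> \<in> space M \<Longrightarrow> W r \<omega> = N\<^sub>\<beta> (E\<^sub>f r \<omega>) \<omega>"
    and "subordinator M' \<phi> D\<^sub>\<phi>"
    and "E\<^sub>\<phi> = inverse_process D\<^sub>\<phi>"
    and "\<And>r. r \<ge> 0 \<Longrightarrow> F r = 1 - (\<integral>\<omega>. exp (- rate * E\<^sub>\<phi> r \<omega>) \<partial>completion M')"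
    and "0 \<le> s" and "s < t" and "m \<le> n"
  shows "(n = m \<longrightarrow>
            \<P>(\<omega> in completion M. W s \<omega> = m \<and> W t \<omega> = m) =
            (LINT u:{0..s}|convolution_power (stieltjes_measure F) m.
               (\<integral>\<omega>. exp (- rate * E\<^sub>\<phi> (t - u) \<omega>) \<partial>completion M'))) \<and>
         (n \<ge> m + 1 \<longrightarrow>
            \<P>(\<omega> in completion M. W s \<omega> = m \<and> W t \<omega> = n) =
            (LINT u:{0..s}|convolution_power (stieltjes_measure F) m.
               (LINT v:{s - u..t - u}|stieltjes_measure F.
                  (LINT x:{0..t - (u + v)}|convolution_power (stieltjes_measure F) (n - m - 1).
                     (\<integral>\<omega>. exp (- rate * E\<^sub>\<phi> (t - u - v - x) \<omega>) \<partial>completion M')))))"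
proof -
  interpret M: prob_space M by fact
  note levy = \<open>levy_measure \<nu>\<close> \<open>emeasure \<nu> {0<..} = \<infinity>\<close> \<open>0 \<le> b\<close>
  have f_pos: "0 < f x" if "0 < x" for x
    using bernstein_function_pos[OF levy that] assms(9)[OF that] by simp
  have \<phi>_unbounded: "\<exists>x>0. C < \<phi> x" for C
  proof -
    \<comment> \<open>The bound is chosen so that the power \<open>\<beta>\<close> returns
      \<open>max 1 C\<close>, which is at least \<open>C\<close>; the maximum keeps the base of the
      power positive.\<close>
    obtain x where x: "0 < x" "max 1 C powr (1 / \<beta>) < bernstein_function b \<nu> x"
      using bernstein_function_unbounded[OF levy] by blast
    then have "(max 1 C powr (1 / \<beta>)) powr \<beta> < f x powr \<beta>"
      using \<open>0 < \<beta>\<close> assms(9)[OF x(1)] by (intro powr_less_mono2) auto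
    then show ?thesis
      using x(1) \<open>0 < \<beta>\<close> assms(10)[OF x(1)] by (intro exI[of _ x]) (simp add: powr_powr)
  qed
  interpret f: unbounded_subordinator M D\<^sub>f f
    using \<open>prob_space M\<close> \<open>subordinator M f D\<^sub>f\<close> f_pos[of 1]
    by (auto simp: unbounded_subordinator_def unbounded_subordinator_axioms_def intro!: exI[of _ 1])
  interpret \<phi>: unbounded_subordinator M' D\<^sub>\<phi> \<phi>
    using \<open>prob_space M'\<close> \<open>subordinator M' \<phi> D\<^sub>\<phi>\<close> \<phi>_unbounded[of 0]
    by (auto simp: unbounded_subordinator_def unbounded_subordinator_axioms_def)
  have Exp: "nonneg_law (exponential_law rate)" by (rule nonneg_law_exponential[OF \<open>0 < rate\<close>])
  obtain Q where Q: "nonneg_law Q"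
    and Q_laplace: "\<And>y. 0 < y \<Longrightarrow> laplace_transform Q y = laplace_transform (exponential_law rate) (y powr \<beta>)"
    and path: "AE \<omega> in completion M. right_continuous_path (\<lambda>r. N\<^sub>\<beta> r \<omega>)"
    and Q_renewal: "\<And>m n a b. m \<le> n \<Longrightarrow> 0 \<le> a \<Longrightarrow> a \<le> b \<Longrightarrow>
      measure (completion M) {\<omega> \<in> space M. N\<^sub>\<beta> a \<omega> = m \<and> N\<^sub>\<beta> b \<omega> = n} = renewal_prob Q m n a b"
    by (rule fractional_poisson_process_renewal[OF \<open>prob_space M\<close> \<open>0 < \<beta>\<close> \<open>0 < rate\<close>
        \<open>fractional_poisson_process M \<beta> rate N\<^sub>\<beta>\<close>]) (rule that; simp)
  let ?dF = "stieltjes_measure F"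
  have F: "F r = 1 - (\<integral>\<omega>. exp (- rate * \<phi>.E r \<omega>) \<partial>completion M')" if "0 \<le> r" for r
    using assms(18)[OF that] \<open>E\<^sub>\<phi> = inverse_process D\<^sub>\<phi>\<close> by simp
  have dF: "?dF = exponential_law rate \<bind> \<phi>.K"
    by (rule \<phi>.stieltjes_measure_eq[OF \<open>0 < rate\<close> F])
  then have dF_law: "nonneg_law ?dF" by (simp add: \<phi>.nonneg_law_bind[OF Exp])
  \<comment> \<open>The only place where \<open>D\<^sub>f\<close> and \<open>D\<^sub>\<phi>\<close>
    meet: at \<open>x\<close> both transforms equal that of the exponential law at
    \<open>f x powr \<beta> = \<phi> x\<close>.\<close>
  have "Q \<bind> f.K = ?dF"
    unfolding dF
  proof (rule laplace_transform_unique[OF f.nonneg_law_bind[OF Q] \<phi>.nonneg_law_bind[OF Exp]])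
    fix x :: real assume x: "0 < x"
    show "laplace_transform (Q \<bind> f.K) x = laplace_transform (exponential_law rate \<bind> \<phi>.K) x"
      using f_pos[OF x] assms(10)[OF x]
      by (simp add: f.laplace_transform_bind[OF Q x] \<phi>.laplace_transform_bind[OF Exp x] Q_laplace)
  qed
  moreover have "{\<omega> \<in> space (completion M). W s \<omega> = m \<and> W t \<omega> = n}
      = {\<omega> \<in> space M. N\<^sub>\<beta> (f.E s \<omega>) \<omega> = m \<and> N\<^sub>\<beta> (f.E t \<omega>) \<omega> = n}"
    using assms(15) \<open>0 \<le> s\<close> \<open>s < t\<close> \<open>E\<^sub>f = inverse_process D\<^sub>f\<close> by auto
  moreover have "measure (completion M) {\<omega> \<in> space M. N\<^sub>\<beta> (f.E s \<omega>) \<omega> = m \<and> N\<^sub>\<beta> (f.E t \<omega>) \<omega> = n}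
      = renewal_prob (Q \<bind> f.K) m n s t"
    using \<open>indep_processes M (\<lambda>r \<omega>. real (N\<^sub>\<beta> r \<omega>)) E\<^sub>f\<close> \<open>E\<^sub>f = inverse_process D\<^sub>f\<close> \<open>0 \<le> s\<close> \<open>s < t\<close>
    by (intro f.renewal_subordinated path Q Q_renewal \<open>m \<le> n\<close>) auto
  ultimately have W: "\<P>(\<omega> in completion M. W s \<omega> = m \<and> W t \<omega> = n) = renewal_prob ?dF m n s t"
    by simp
  have survival: "(\<integral>\<omega>. exp (- rate * E\<^sub>\<phi> c \<omega>) \<partial>completion M') = measure ?dF {c<..}" if "0 \<le> c" for c
  proof -
    interpret dF: nonneg_law ?dF by (rule dF_law)
    show ?thesis
      using dF.measure_greaterThan[of c] \<phi>.cdf_exponential_bind[OF \<open>0 < rate\<close> that] \<open>E\<^sub>\<phi> = inverse_process D\<^sub>\<phi>\<close> by (simp add: dF)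
  qed
  have atomless: "measure ?dF {c} = 0" if "0 \<le> c" for c
    unfolding dF by (rule \<phi>.exponential_bind_atomless[OF \<phi>_unbounded \<open>0 < rate\<close> that])
  have "s \<le> t" using \<open>s < t\<close> by simp
  show ?thesis
  proof (intro conjI impI)
    assume "n = m"
    then show "\<P>(\<omega> in completion M. W s \<omega> = m \<and> W t \<omega> = m) =
        (LINT u:{0..s}|convolution_power ?dF m. (\<integral>\<omega>. exp (- rate * E\<^sub>\<phi> (t - u) \<omega>) \<partial>completion M'))"
      using W set_integral_no_jump[OF dF_law \<open>0 \<le> s\<close> \<open>s \<le> t\<close> survival] by simp
  next
    assume "m + 1 \<le> n"
    then have n: "n = m + 1 + (n - m - 1)" by simp
    show "\<P>(\<omega> in completion M. W s \<omega> = m \<and> W t \<omega> = n) =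
            (LINT u:{0..s}|convolution_power ?dF m.
               (LINT v:{s - u..t - u}|?dF.
                  (LINT x:{0..t - (u + v)}|convolution_power ?dF (n - m - 1).
                     (\<integral>\<omega>. exp (- rate * E\<^sub>\<phi> (t - u - v - x) \<omega>) \<partial>completion M'))))"
      using set_integral_jump[OF dF_law \<open>0 \<le> s\<close> \<open>s \<le> t\<close> atomless survival, of m "n - m - 1"]
      unfolding W n[symmetric] by (rule sym)
  qed
qed

end
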